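(* In the deterministic $\mathsf{LOCAL}$ model, there is no distributed algorithm that solves weak $2$-coloring on all graphs in which every node has odd degree and whose running time on graphs of maximum degree $\Delta$ is $T(\Delta)$ for some function $T$ with $T(\Delta)\in o(\log^*\Delta)$.
   Context: Weak $2$-coloring: each node outputs a color from $\{1,2\}$ such that every node of degree at least $1$ has at least one neighbor with a different color. $\mathsf{LOCAL}$ model: the nodes of the (simple, connected) input graph with $n$ nodes and maximum degree $\Delta$ are processors with globally unique identifiers that are $O(\log n)$-bit strings; each node knows $n$ and $\Delta$; computation proceeds in synchronous rounds in which every node sends arbitrarily large messages to its neighbors and performs arbitrary local computation; the running time is the number of rounds until all nodes have terminated and produced their outputs, in the worst case. $\log^*$ is the iterated logarithm. *)

theory Defs
  imports Complex_Main "HOL-Library.Landau_Symbols"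
begin

definition log_star :: "real \<Rightarrow> nat" where
  "log_star x = (LEAST k. ((\<lambda>y. log 2 y) ^^ k) x \<le> 1)"

text \<open>Graphs: vertices are the (unique) identifiers themselves, i.e. natural numbers;
  edges are 2-element subsets of the vertex set (simple undirected graph).\<close>
type_synonym graph = "nat set \<times> nat set set"

definition simple_graph :: "graph \<Rightarrow> bool" where
  "simple_graph G \<longleftrightarrow> finite (fst G) \<and> fst G \<noteq> {} \<and>
     (\<forall>e\<in>snd G. e \<subseteq> fst G \<and> card e = 2)"

definition nbrs :: "graph \<Rightarrow> nat \<Rightarrow> nat set" where
  "nbrs G v = {u. {u, v} \<in> snd G}"

definition deg :: "graph \<Rightarrow> nat \<Rightarrow> nat" where
  "deg G v = card (nbrs G v)"

definition max_deg :: "graph \<Rightarrow> nat" where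
  "max_deg G = Max (deg G ` fst G)"

fun reach_le :: "graph \<Rightarrow> nat \<Rightarrow> nat \<Rightarrow> nat \<Rightarrow> bool" where
  "reach_le G v u 0 \<longleftrightarrow> u = v \<and> v \<in> fst G"
| "reach_le G v u (Suc k) \<longleftrightarrow> reach_le G v u k \<or> (\<exists>w. reach_le G v w k \<and> {w, u} \<in> snd G)"

definition connected_graph :: "graph \<Rightarrow> bool" where
  "connected_graph G \<longleftrightarrow> (\<forall>u\<in>fst G. \<forall>w\<in>fst G. \<exists>k. reach_le G u w k)"

text \<open>The information a node v has gathered after T rounds of the LOCAL model:
  the identifiers of all nodes at distance at most T, all edges incident to a node at
  distance less than T, and the degree (initial knowledge) of every node at distance at most T.\<close>
type_synonym view = "nat set \<times> nat set set \<times> (nat \<Rightarrow> nat)"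

definition local_view :: "graph \<Rightarrow> nat \<Rightarrow> nat \<Rightarrow> view" where
  "local_view G T v =
     ({u. reach_le G v u T},
      {e \<in> snd G. \<exists>u\<in>e. T > 0 \<and> reach_le G v u (T - 1)},
      (\<lambda>u. if reach_le G v u T then deg G u else 0))"

text \<open>A deterministic LOCAL algorithm with running time T(\<Delta>): the output of node v is an
  arbitrary function of n, \<Delta>, its own identifier, and its radius-T(\<Delta>) view.\<close>
type_synonym algorithm = "nat \<Rightarrow> nat \<Rightarrow> view \<Rightarrow> nat \<Rightarrow> nat"

definition run :: "algorithm \<Rightarrow> (nat \<Rightarrow> nat) \<Rightarrow> graph \<Rightarrow> nat \<Rightarrow> nat" where
  "run A T G v = A (card (fst G)) (max_deg G) (local_view G (T (max_deg G)) v) v"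

definition weak_2_coloring :: "graph \<Rightarrow> (nat \<Rightarrow> nat) \<Rightarrow> bool" where
  "weak_2_coloring G col \<longleftrightarrow>
     (\<forall>v\<in>fst G. col v \<in> {1, 2} \<and> (deg G v \<ge> 1 \<longrightarrow> (\<exists>u\<in>nbrs G v. col u \<noteq> col v)))"

text \<open>Admissible instances: simple connected graphs with identifiers in {1..n^c}
  (O(log n)-bit identifiers) in which every node has odd degree.\<close>
definition odd_instance :: "nat \<Rightarrow> graph \<Rightarrow> bool" where
  "odd_instance c G \<longleftrightarrow> simple_graph G \<and> connected_graph G \<and>
     fst G \<subseteq> {1 .. card (fst G) ^ c} \<and> (\<forall>v\<in>fst G. odd (deg G v))"

definition solves_weak2_odd :: "nat \<Rightarrow> algorithm \<Rightarrow> (nat \<Rightarrow> nat) \<Rightarrow> bool" where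
  "solves_weak2_odd c A T \<longleftrightarrow> (\<forall>G. odd_instance c G \<longrightarrow> weak_2_coloring G (run A T G))"

end

theory Submission
  imports Defs "HOL-Library.Ramsey"
begin

text \<open>Let \<open>\<Delta> = 2 m + 1\<close>. By Ramsey's theorem, for large \<open>n\<close> there is a set of identifiers on which the
  output of a \<open>T\<close>-round algorithm depends only on their relative order. A \<open>\<Delta>\<close>-regular tree with port
  numbers in which every node has \<open>m + 1\<close> outgoing and \<open>m\<close> incoming ports carries a linear order that can
  be read off locally, so on such trees the identifiers can be discarded altogether.

  The remaining algorithms are treated by round elimination. In a superweak \<open>k\<close>-coloring every node
  chooses one of \<open>k\<close> colors, some demanding ports and fewer, and at most \<open>k\<close>, accepting ports; a demanding
  port must lead to a node of a different color or to an accepting port. A weak 2-coloring yields a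
  superweak 2-coloring in one more round. From \<open>t + 1\<close> rounds and \<open>k\<close> colors one gets to \<open>t\<close> rounds and a
  number of colors that is seven exponentials larger, and zero rounds are impossible for \<open>k < m\<close>.
  Hence \<open>T\<close> is at least a constant times \<open>log\<^sup>* \<Delta>\<close>.\<close>

subsection \<open>Matchings\<close>

definition hall_condition :: "'a set \<Rightarrow> ('a \<Rightarrow> 'b set) \<Rightarrow> bool" where
  "hall_condition X N \<longleftrightarrow> (\<forall>S\<subseteq>X. card S \<le> card (\<Union>(N ` S)))"

lemma hall_conditionD: "hall_condition X N \<Longrightarrow> S \<subseteq> X \<Longrightarrow> card S \<le> card (\<Union>(N ` S))"
  by (simp add: hall_condition_def)

lemma hall_condition_violation:
  assumes "hall_condition X N" "\<not> hall_condition X (N(x := N'))" "finite X"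
  shows "\<exists>A\<subseteq>X - {x}. card (\<Union>(N ` A) \<union> N') \<le> card A"
proof -
  obtain S where S: "S \<subseteq> X" "card (\<Union>((N(x := N')) ` S)) < card S"
    using assms(2) unfolding hall_condition_def by (meson not_le)
  have "x \<in> S"
  proof (rule ccontr)
    assume "x \<notin> S"
    then have "(N(x := N')) ` S = N ` S" by auto
    then show False using S hall_conditionD[OF assms(1)] by (metis not_le)
  qed
  then have "\<Union>((N(x := N')) ` S) = \<Union>(N ` (S - {x})) \<union> N'" by auto
  moreover have "card S = Suc (card (S - {x}))"
    using \<open>x \<in> S\<close> S(1) assms(3) by (metis card.remove finite_subset)
  ultimately show ?thesis using S by (intro exI[of _ "S - {x}"]) auto
qed

lemma hall_condition_remove:
  assumes X: "finite X" "\<And>x. x \<in> X \<Longrightarrow> finite (N x)" and hall: "hall_condition X N"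
    and x: "x \<in> X" and "y \<noteq> z"
  shows "hall_condition X (N(x := N x - {y})) \<or> hall_condition X (N(x := N x - {z}))"
proof (rule ccontr)
  assume "\<not> ?thesis"
  then obtain A B where
    A: "A \<subseteq> X - {x}" "card (\<Union>(N ` A) \<union> (N x - {y})) \<le> card A" and
    B: "B \<subseteq> X - {x}" "card (\<Union>(N ` B) \<union> (N x - {z})) \<le> card B"
    using hall_condition_violation[OF hall _ X(1)] by meson
  let ?U = "\<Union>(N ` A) \<union> (N x - {y})" and ?V = "\<Union>(N ` B) \<union> (N x - {z})"
  have fin: "finite A" "finite B" using A(1) B(1) X(1) by (auto intro: finite_subset)
  have finN: "finite (N a)" if "a \<in> A \<union> B \<union> {x}" for a
    using that A(1) B(1) x by (intro X(2)) auto
  have UV: "finite ?U" "finite ?V" using fin finN by auto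
  have "x \<notin> A \<union> B" using A(1) B(1) by blast
  then have "Suc (card (A \<union> B)) = card (insert x (A \<union> B))" using fin by simp
  also have "\<dots> \<le> card (\<Union>(N ` insert x (A \<union> B)))"
    using A(1) B(1) x by (intro hall_conditionD[OF hall]) auto
  also have "\<dots> \<le> card (?U \<union> ?V)"
    using UV \<open>y \<noteq> z\<close> by (intro card_mono) auto
  finally have union: "Suc (card (A \<union> B)) \<le> card (?U \<union> ?V)" .
  have "card (A \<inter> B) \<le> card (\<Union>(N ` (A \<inter> B)))"
    using A(1) by (intro hall_conditionD[OF hall]) auto
  also have "\<dots> \<le> card (?U \<inter> ?V)" using UV by (intro card_mono) auto
  finally show False
    using union A(2) B(2) card_Un_Int[OF UV] card_Un_Int[OF fin] by linarith
qed

lemma hall_marriage_card_less_2: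
  assumes hall: "hall_condition X N" and small: "\<And>x. x \<in> X \<Longrightarrow> card (N x) < 2"
  shows "\<exists>f. inj_on f X \<and> (\<forall>x\<in>X. f x \<in> N x)"
proof -
  have "1 \<le> card (N x)" if "x \<in> X" for x
    using hall_conditionD[OF hall, of "{x}"] that by simp
  then have "\<exists>y. N x = {y}" if "x \<in> X" for x
    using small that by (metis One_nat_def Suc_1 card_1_singletonE le_antisym not_less_eq_eq not_le)
  then obtain f where f: "\<And>x. x \<in> X \<Longrightarrow> N x = {f x}" by metis
  have "inj_on f X"
  proof (rule inj_onI, rule ccontr)
    fix x y assume "x \<in> X" "y \<in> X" "f x = f y" "x \<noteq> y"
    then show False using hall_conditionD[OF hall, of "{x, y}"] f by simp
  qed
  then show ?thesis using f by blast
qed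

theorem hall_marriage:
  assumes "finite X" "\<And>x. x \<in> X \<Longrightarrow> finite (N x)" "hall_condition X N"
  shows "\<exists>f. inj_on f X \<and> (\<forall>x\<in>X. f x \<in> N x)"
  using assms(2,3)
proof (induction "\<Sum>x\<in>X. card (N x)" arbitrary: N rule: less_induct)
  case less
  show ?case
  proof (cases "\<exists>x\<in>X. 2 \<le> card (N x)")
    case True
    then obtain x Y where x: "x \<in> X" and "Y \<subseteq> N x" "card Y = 2"
      by (meson obtain_subset_with_card_n)
    then obtain y z where "{y, z} \<subseteq> N x" "y \<noteq> z" by (metis card_2_iff)
    then obtain w where w: "w \<in> N x" and hall: "hall_condition X (N(x := N x - {w}))"
      using hall_condition_remove[OF assms(1) less.prems x] by blast
    let ?N = "N(x := N x - {w})"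
    have "(\<Sum>u\<in>X. card (?N u)) < (\<Sum>u\<in>X. card (N u))"
    proof (rule sum_strict_mono_ex1)
      show "\<forall>u\<in>X. card (?N u) \<le> card (N u)"
        using less.prems(1) by (simp add: card_Diff1_le)
      show "\<exists>u\<in>X. card (?N u) < card (N u)"
        using card_Diff1_less[OF less.prems(1)[OF x] w] x by (intro bexI[of _ x]) simp_all
    qed (rule assms(1))
    then have "\<exists>f. inj_on f X \<and> (\<forall>u\<in>X. f u \<in> ?N u)"
      using less.prems(1) by (intro less.hyps hall) auto
    then obtain f where f: "inj_on f X" "\<And>u. u \<in> X \<Longrightarrow> f u \<in> ?N u" by blast
    have "f u \<in> N u" if "u \<in> X" for u
      using f(2)[OF that] by (cases "u = x") simp_all
    then show ?thesis using f(1) by blast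
  next
    case False
    then show ?thesis using less.prems(2) by (intro hall_marriage_card_less_2) (auto simp: not_le)
  qed
qed

corollary distinct_representatives_of_large_sets:
  assumes X: "finite X" and N: "\<And>x. x \<in> X \<Longrightarrow> finite (N x) \<and> card X \<le> card (N x)"
  shows "\<exists>f. inj_on f X \<and> (\<forall>x\<in>X. f x \<in> N x)"
proof (rule hall_marriage[OF X])
  show "hall_condition X N"
    unfolding hall_condition_def
  proof (intro allI impI)
    fix S assume S: "S \<subseteq> X"
    show "card S \<le> card (\<Union>(N ` S))"
    proof (cases "S = {}")
      case False
      then obtain x where x: "x \<in> S" by blast
      have "card S \<le> card X" using X S by (rule card_mono)
      also have "\<dots> \<le> card (N x)" using x S N by blast
      also have "\<dots> \<le> card (\<Union>(N ` S))"
        using x S N finite_subset[OF S X] by (intro card_mono finite_UN_I) auto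
      finally show ?thesis .
    qed simp
  qed
qed (use N in blast)

lemma inj_on_disjoint_images_Un:
  assumes "inj_on f A" "inj_on f B" "f ` A \<inter> f ` B = {}"
  shows "inj_on f (A \<union> B)"
  using assms by (auto simp: inj_on_Un)

theorem mendelsohn_dulmage:
  assumes f: "inj_on f X" and g: "inj_on g Y"
  shows "\<exists>M \<subseteq> (\<lambda>x. (x, f x)) ` X \<union> (\<lambda>y. (g y, y)) ` Y.
    inj_on fst M \<and> inj_on snd M \<and> X \<subseteq> Domain M \<and> Y \<subseteq> Range M"
proof -
  define \<Phi> where "\<Phi> S = g ` (Y - f ` (X - S))" for S
  have "mono \<Phi>" unfolding \<Phi>_def by (rule monoI) blast
  then obtain Z where Z: "Z = g ` (Y - f ` (X - Z))"
    using lfp_unfold unfolding \<Phi>_def by blast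
  define W where "W = f ` (X - Z)"
  have ZW: "Z = g ` (Y - W)" using Z unfolding W_def .
  define F where "F = (\<lambda>x. (x, f x)) ` (X - Z)"
  define G where "G = (\<lambda>y. (g y, y)) ` (Y - W)"
  have fst_images: "fst ` F = X - Z" "fst ` G = Z" unfolding F_def G_def ZW by force+
  have snd_images: "snd ` F = W" "snd ` G = Y - W" unfolding F_def G_def W_def by force+
  have "inj_on fst F" "inj_on snd G" unfolding F_def G_def by (auto simp: inj_on_def)
  moreover have "inj_on snd F" using f unfolding F_def by (auto simp: inj_on_def)
  moreover have "inj_on fst G" using g unfolding G_def by (auto simp: inj_on_def)
  ultimately have "inj_on fst (F \<union> G)" "inj_on snd (F \<union> G)"
    using fst_images snd_images by (auto intro!: inj_on_disjoint_images_Un)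
  moreover have "X \<subseteq> Domain (F \<union> G)" "Y \<subseteq> Range (F \<union> G)"
    using fst_images snd_images by (auto simp: Domain_fst Range_snd image_Un)
  moreover have "F \<union> G \<subseteq> (\<lambda>x. (x, f x)) ` X \<union> (\<lambda>y. (g y, y)) ` Y"
    unfolding F_def G_def by blast
  ultimately show ?thesis by blast
qed

definition matching :: "('a \<times> 'a) set \<Rightarrow> bool" where
  "matching M \<longleftrightarrow> inj_on fst M \<and> inj_on snd M \<and> Domain M \<inter> Range M = {}"

lemma Field_eq_images: "Field M = fst ` M \<union> snd ` M"
  by (simp add: Field_def Domain_fst Range_snd)

lemma matching_Un:
  assumes M: "matching M" and M': "matching M'" and disj: "Field M \<inter> Field M' = {}"
  shows "matching (M \<union> M')"
proof -
  have cross: "fst ` M \<inter> fst ` M' = {}" "snd ` M \<inter> snd ` M' = {}"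
    "fst ` M \<inter> snd ` M' = {}" "snd ` M \<inter> fst ` M' = {}"
    using disj by (simp_all add: Field_eq_images Int_Un_distrib Int_Un_distrib2)
  have "inj_on fst (M \<union> M')" "inj_on snd (M \<union> M')"
    using M M' cross(1,2) by (simp_all add: matching_def inj_on_disjoint_images_Un)
  moreover have "Domain (M \<union> M') \<inter> Range (M \<union> M') = {}"
    using M M' cross(3,4)
    by (simp add: matching_def Domain_fst Range_snd image_Un Int_Un_distrib Int_Un_distrib2
        Int_commute)
  ultimately show ?thesis by (simp add: matching_def)
qed

lemma matching_image_Pair:
  assumes "inj_on f A" "inj_on g A" "f ` A \<inter> g ` A = {}"
  shows "matching ((\<lambda>x. (f x, g x)) ` A)"
  using assms unfolding matching_def Domain_fst Range_snd
  by (auto simp: inj_on_def image_image)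

lemma Field_image_Pair: "Field ((\<lambda>x. (f x, g x)) ` A) = f ` A \<union> g ` A"
  by (simp add: Field_eq_images image_image)

lemma card_Field_matching:
  assumes "matching M" "finite M"
  shows "card {x \<in> Field M. Q x} = card {e \<in> M. Q (fst e)} + card {e \<in> M. Q (snd e)}"
proof -
  have "{x \<in> Field M. Q x} = fst ` {e \<in> M. Q (fst e)} \<union> snd ` {e \<in> M. Q (snd e)}"
    by (auto simp: Field_eq_images)
  also have "card \<dots> = card (fst ` {e \<in> M. Q (fst e)}) + card (snd ` {e \<in> M. Q (snd e)})"
    using assms unfolding matching_def Domain_fst Range_snd by (intro card_Un_disjoint) auto
  also have "card (fst ` {e \<in> M. Q (fst e)}) = card {e \<in> M. Q (fst e)}"
    using assms(1) unfolding matching_def by (auto intro!: card_image intro: inj_on_subset)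
  also have "card (snd ` {e \<in> M. Q (snd e)}) = card {e \<in> M. Q (snd e)}"
    using assms(1) unfolding matching_def by (auto intro!: card_image intro: inj_on_subset)
  finally show ?thesis .
qed

lemma ex_labelling_of_matching:
  assumes "matching M"
  shows "\<exists>s. (\<forall>e\<in>M. s (fst e) = f e \<and> s (snd e) = g e) \<and> (\<forall>x. x \<notin> Field M \<longrightarrow> s x = d x)"
proof -
  have M: "inj_on fst M" "inj_on snd M" "fst ` M \<inter> snd ` M = {}"
    using assms by (simp_all add: matching_def Domain_fst Range_snd)
  define s where "s x = (if x \<in> fst ` M then f (the_inv_into M fst x)
    else if x \<in> snd ` M then g (the_inv_into M snd x) else d x)" for x
  have "s (fst e) = f e \<and> s (snd e) = g e" if "e \<in> M" for e
  proof -
    have "snd e \<notin> fst ` M" using that M(3) by blast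
    then show ?thesis using that M by (simp add: s_def the_inv_into_f_f)
  qed
  moreover have "s x = d x" if "x \<notin> Field M" for x
    using that by (simp add: s_def Field_eq_images)
  ultimately show ?thesis by blast
qed

subsection \<open>Deficient sets of port types\<close>

text \<open>The first component is the orientation of the port. Each pair of the second component consists of
  the colors with which the node may demand along the edge and of those with which it must accept.\<close>

type_synonym 'c port_type = "bool \<times> ('c set \<times> 'c set) set"

definition compatible :: "'c port_type \<Rightarrow> 'c port_type \<Rightarrow> bool" where
  "compatible Q Q' \<longleftrightarrow> fst Q \<noteq> fst Q' \<and> (\<exists>a b. (a, b) \<in> snd Q \<and> (b, a) \<in> snd Q')"

lemma compatible_sym: "compatible Q Q' \<Longrightarrow> compatible Q' Q"
  unfolding compatible_def by metis

lemma compatible_fst: "compatible Q Q' \<Longrightarrow> fst Q' \<longleftrightarrow> \<not> fst Q"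
  unfolding compatible_def by blast

definition compatible_matching :: "('p \<Rightarrow> 'c port_type) \<Rightarrow> ('p \<times> 'p) set \<Rightarrow> bool" where
  "compatible_matching ty M \<longleftrightarrow> matching M \<and> (\<forall>e\<in>M. compatible (ty (fst e)) (ty (snd e)))"

lemma compatible_matching_Un:
  "compatible_matching ty M \<Longrightarrow> compatible_matching ty M' \<Longrightarrow> Field M \<inter> Field M' = {} \<Longrightarrow>
     compatible_matching ty (M \<union> M')"
  by (auto simp: compatible_matching_def matching_Un)

definition edges_between ::
  "('p \<Rightarrow> 'q) \<Rightarrow> ('p \<times> 'p) set \<Rightarrow> 'q \<Rightarrow> 'q \<Rightarrow> ('p \<times> 'p) set" where
  "edges_between ty M Q Q' = {e \<in> M. ty (fst e) = Q \<and> ty (snd e) = Q'}"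

definition ports_of :: "'p set \<Rightarrow> ('p \<Rightarrow> 'q) \<Rightarrow> 'q set \<Rightarrow> 'p set" where
  "ports_of P ty X = {p \<in> P. ty p \<in> X}"

definition nbr_ports :: "'p set \<Rightarrow> ('p \<Rightarrow> 'c port_type) \<Rightarrow> 'c port_type set \<Rightarrow> 'p set" where
  "nbr_ports P ty X = {p \<in> P. \<exists>Q\<in>X. compatible Q (ty p)}"

definition deficient :: "'p set \<Rightarrow> ('p \<Rightarrow> 'c port_type) \<Rightarrow> nat \<Rightarrow> 'c port_type set \<Rightarrow> bool" where
  "deficient P ty b X \<longleftrightarrow>
     card (nbr_ports P ty X) < card (ports_of P ty X) \<and> card (nbr_ports P ty X) \<le> b"

definition demand_count :: "'p set \<Rightarrow> ('p \<Rightarrow> 'c set \<times> 'c set) \<Rightarrow> 'c \<Rightarrow> nat" where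
  "demand_count P s c = card {p \<in> P. c \<in> fst (s p)}"

definition accept_count :: "'p set \<Rightarrow> ('p \<Rightarrow> 'c set \<times> 'c set) \<Rightarrow> 'c \<Rightarrow> nat" where
  "accept_count P s c = card {p \<in> P. c \<in> snd (s p)}"

definition balanced_selection ::
  "'p set \<Rightarrow> ('p \<Rightarrow> 'c port_type) \<Rightarrow> nat \<Rightarrow> ('p \<Rightarrow> 'c set \<times> 'c set) \<Rightarrow> bool" where
  "balanced_selection P ty k s \<longleftrightarrow> (\<forall>p\<in>P. s p \<in> snd (ty p)) \<and>
     (\<forall>c. demand_count P s c \<le> accept_count P s c \<or> k < accept_count P s c)"

lemma card_ports_of_le:
  assumes "finite X" "\<And>Q. Q \<in> X \<Longrightarrow> card (ports_of P ty {Q}) \<le> t"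
  shows "card (ports_of P ty X) \<le> card X * t"
proof -
  have "card (ports_of P ty X) = card (\<Union>Q\<in>X. ports_of P ty {Q})"
    by (intro arg_cong[of _ _ card]) (auto simp: ports_of_def)
  also have "\<dots> \<le> (\<Sum>Q\<in>X. card (ports_of P ty {Q}))"
    by (rule card_UN_le[OF assms(1)])
  also have "\<dots> \<le> card X * t"
    using sum_bounded_above[of X _ t] assms(2) by simp
  finally show ?thesis .
qed

lemma ex_common_pair:
  "\<exists>w. \<forall>Q Q'. compatible Q Q' \<longrightarrow> w Q Q' \<in> snd Q \<and> prod.swap (w Q Q') \<in> snd Q'"
proof -
  have "\<exists>v. v \<in> snd Q \<and> prod.swap v \<in> snd Q'" if QQ': "compatible Q Q'"
    for Q Q' :: "'a port_type"
  proof -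
    obtain a b where "(a, b) \<in> snd Q" "(b, a) \<in> snd Q'"
      using QQ' unfolding compatible_def by blast
    then show ?thesis by (intro exI[of _ "(a, b)"]) simp
  qed
  then show ?thesis by metis
qed

lemma demand_count_eq_accept_count:
  assumes M: "matching M" "finite M" "Field M \<subseteq> P"
    and s: "\<And>e. e \<in> M \<Longrightarrow> s (snd e) = prod.swap (s (fst e))"
    and unmatched: "\<And>p. p \<in> P - Field M \<Longrightarrow> c \<notin> fst (s p) \<union> snd (s p)"
  shows "demand_count P s c = accept_count P s c"
proof -
  have "{p \<in> P. c \<in> fst (s p)} = {p \<in> Field M. c \<in> fst (s p)}"
    "{p \<in> P. c \<in> snd (s p)} = {p \<in> Field M. c \<in> snd (s p)}"
    using M(3) unmatched by blast+
  moreover have "{e \<in> M. c \<in> fst (s (snd e))} = {e \<in> M. c \<in> snd (s (fst e))}"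
    "{e \<in> M. c \<in> snd (s (snd e))} = {e \<in> M. c \<in> fst (s (fst e))}"
    using s by auto
  ultimately show ?thesis
    unfolding demand_count_def accept_count_def by (simp add: card_Field_matching[OF M(1,2)])
qed

lemma card_le_accept_count:
  assumes P: "finite P" and M: "matching M" "Field M \<subseteq> P" and K: "K \<subseteq> M"
    and s: "\<And>e. e \<in> K \<Longrightarrow> s (fst e) = v \<and> s (snd e) = prod.swap v" and c: "c \<in> fst v \<union> snd v"
  shows "card K \<le> accept_count P s c"
proof -
  have KP: "fst e \<in> P" "snd e \<in> P" if "e \<in> K" for e
    using that K M(2) by (auto simp: Field_eq_images)
  obtain g where "inj_on g K" "g ` K \<subseteq> {p \<in> P. c \<in> snd (s p)}"
  proof (cases "c \<in> snd v")
    case True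
    have "inj_on fst K" using M(1) K unfolding matching_def by (blast intro: inj_on_subset)
    moreover have "fst ` K \<subseteq> {p \<in> P. c \<in> snd (s p)}" using True s KP by auto
    ultimately show ?thesis by (rule that)
  next
    case False
    have "inj_on snd K" using M(1) K unfolding matching_def by (blast intro: inj_on_subset)
    moreover have "snd ` K \<subseteq> {p \<in> P. c \<in> snd (s p)}" using False c s KP by auto
    ultimately show ?thesis by (rule that)
  qed
  then show ?thesis
    unfolding accept_count_def using P by (intro card_inj_on_le) simp_all
qed

text \<open>The two ports of a pair receive swapped values, so their contributions cancel. Every color that
  occurs in the value of an unpaired port occurs on the second side of more than \<open>k\<close> ports, because
  the pairs of types \<open>Q\<close> and \<open>par Q\<close> receive the same value as the unpaired ports of type \<open>Q\<close>.\<close>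

lemma ex_balanced_selection_of_matching:
  fixes ty :: "'p \<Rightarrow> 'c port_type"
  assumes P: "finite P" and M: "compatible_matching ty M" "Field M \<subseteq> P"
    and par: "\<And>p. p \<in> P - Field M \<Longrightarrow> compatible (ty p) (par (ty p))"
    and many: "\<And>p. p \<in> P - Field M \<Longrightarrow> k < card (edges_between ty M (ty p) (par (ty p)))"
  shows "\<exists>s. balanced_selection P ty k s"
proof -
  have matching: "matching M" and compat: "\<And>e. e \<in> M \<Longrightarrow> compatible (ty (fst e)) (ty (snd e))"
    using M(1) by (auto simp: compatible_matching_def)
  obtain w where w: "\<And>Q Q' :: 'c port_type. compatible Q Q' \<Longrightarrow>
      w Q Q' \<in> snd Q \<and> prod.swap (w Q Q') \<in> snd Q'"
    using ex_common_pair by metis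
  define v where "v e = w (ty (fst e)) (ty (snd e))" for e
  obtain s where s: "\<And>e. e \<in> M \<Longrightarrow> s (fst e) = v e" "\<And>e. e \<in> M \<Longrightarrow> s (snd e) = prod.swap (v e)"
      "\<And>p. p \<notin> Field M \<Longrightarrow> s p = w (ty p) (par (ty p))"
    using ex_labelling_of_matching[OF matching, of v "prod.swap \<circ> v" "\<lambda>p. w (ty p) (par (ty p))"]
    by auto
  have "s p \<in> snd (ty p)" if "p \<in> P" for p
  proof (cases "p \<in> Field M")
    case True
    then consider e where "e \<in> M" "p = fst e" | e where "e \<in> M" "p = snd e"
      by (auto simp: Field_eq_images)
    then show ?thesis using s(1,2) w compat by cases (simp_all add: v_def)
  next
    case False
    then show ?thesis using s(3) w par that by simp
  qed
  moreover have "demand_count P s c \<le> accept_count P s c \<or> k < accept_count P s c" for c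
  proof (cases "\<exists>p\<in>P - Field M. c \<in> fst (s p) \<union> snd (s p)")
    case True
    then obtain p where p: "p \<in> P - Field M" "c \<in> fst (s p) \<union> snd (s p)" by blast
    have "card (edges_between ty M (ty p) (par (ty p))) \<le> accept_count P s c"
      using p s by (intro card_le_accept_count[OF P matching M(2), where v = "s p"])
        (auto simp: v_def edges_between_def)
    then show ?thesis using many[OF p(1)] by linarith
  next
    case False
    have "finite (fst ` M)" using M(2) P by (auto simp: Field_eq_images intro: finite_subset)
    then have "finite M" using matching unfolding matching_def by (blast dest: finite_imageD)
    then have "demand_count P s c = accept_count P s c"
      using matching M(2) s(1,2) False by (intro demand_count_eq_accept_count) auto
    then show ?thesis by simp
  qed
  ultimately show ?thesis unfolding balanced_selection_def by blast
qed

locale frequent_types =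
  fixes P :: "'p set" and ty :: "'p \<Rightarrow> 'c port_type" and Fr :: "'c port_type set" and k :: nat
  assumes finite_ports: "finite P" and finite_frequent: "finite Fr"
    and card_frequent_ports: "\<And>Q. Q \<in> Fr \<Longrightarrow>
      card (ports_of P ty (- Fr)) + card Fr * (2 * Suc k) \<le> card (ports_of P ty {Q})"
    and card_ports_le_nbr_ports: "\<And>X. X \<subseteq> ty ` P \<Longrightarrow> nbr_ports P ty X \<subseteq> ports_of P ty (- Fr) \<Longrightarrow>
      card (ports_of P ty X) \<le> card (nbr_ports P ty X)"
begin

abbreviation infrequent :: "'p set" where
  "infrequent \<equiv> ports_of P ty (- Fr)"

definition stranded :: "'p set" where
  "stranded = {p \<in> infrequent. \<forall>Q\<in>Fr. \<not> compatible (ty p) Q}"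

definition slots :: "('c port_type \<times> nat) set" where
  "slots = Fr \<times> {..k}"

lemma finite_infrequent: "finite infrequent"
  using finite_ports by (simp add: ports_of_def)

lemma ex_frequent_compatible:
  assumes Q: "Q \<in> Fr"
  shows "\<exists>Q'\<in>Fr. compatible Q Q'"
proof (rule ccontr)
  assume "\<not> ?thesis"
  then have nbrs: "nbr_ports P ty {Q} \<subseteq> infrequent"
    by (auto simp: nbr_ports_def ports_of_def)
  have "0 < card Fr" using Q finite_frequent card_gt_0_iff by blast
  then have "0 < card Fr * (2 * Suc k)" by simp
  then have many: "card infrequent < card (ports_of P ty {Q})"
    using card_frequent_ports[OF Q] by linarith
  then have "ports_of P ty {Q} \<noteq> {}" by force
  then have "{Q} \<subseteq> ty ` P" by (auto simp: ports_of_def)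
  then have "card (ports_of P ty {Q}) \<le> card infrequent"
    using card_ports_le_nbr_ports[OF _ nbrs] card_mono[OF finite_infrequent nbrs] by linarith
  then show False using many by simp
qed

lemma ex_inj_stranded:
  "\<exists>h. inj_on h stranded \<and> (\<forall>p\<in>stranded. h p \<in> infrequent \<and> compatible (ty p) (ty (h p)))"
proof -
  define nbrs where "nbrs p = {q \<in> P. compatible (ty p) (ty q)}" for p
  have nbrs_infrequent: "nbrs p \<subseteq> infrequent" if "p \<in> stranded" for p
    using that by (auto simp: nbrs_def stranded_def ports_of_def)
  have stranded_ports: "stranded \<subseteq> P" by (auto simp: stranded_def ports_of_def)
  have "hall_condition stranded nbrs"
    unfolding hall_condition_def
  proof (intro allI impI)
    fix S assume S: "S \<subseteq> stranded"
    have nbr_ports: "nbr_ports P ty (ty ` S) = \<Union>(nbrs ` S)"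
      by (auto simp: nbr_ports_def nbrs_def)
    have "card S \<le> card (ports_of P ty (ty ` S))"
      using finite_ports S stranded_ports by (intro card_mono) (auto simp: ports_of_def)
    also have "\<dots> \<le> card (nbr_ports P ty (ty ` S))"
      using S stranded_ports nbrs_infrequent
      by (intro card_ports_le_nbr_ports) (auto simp: nbr_ports)
    finally show "card S \<le> card (\<Union>(nbrs ` S))" unfolding nbr_ports .
  qed
  then obtain h where "inj_on h stranded" "\<And>p. p \<in> stranded \<Longrightarrow> h p \<in> nbrs p"
    using hall_marriage[of stranded nbrs] finite_ports finite_subset[OF stranded_ports]
    by (auto simp: nbrs_def)
  then show ?thesis using nbrs_infrequent by (intro exI[of _ h]) (auto simp: nbrs_def)
qed

text \<open>The outgoing and the incoming stranded ports are matched separately; the two matchings merge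
  because compatible types have opposite orientations.\<close>

lemma ex_matching_stranded:
  "\<exists>M. compatible_matching ty M \<and> stranded \<subseteq> Field M \<and> Field M \<subseteq> infrequent"
proof -
  obtain h where h: "inj_on h stranded"
      "\<And>p. p \<in> stranded \<Longrightarrow> h p \<in> infrequent \<and> compatible (ty p) (ty (h p))"
    using ex_inj_stranded by blast
  define Out where "Out = {p \<in> stranded. fst (ty p)}"
  define In where "In = {p \<in> stranded. \<not> fst (ty p)}"
  have "inj_on h Out" "inj_on h In"
    using h(1) by (auto simp: Out_def In_def intro: inj_on_subset)
  from mendelsohn_dulmage[OF this] obtain M
    where M: "M \<subseteq> (\<lambda>p. (p, h p)) ` Out \<union> (\<lambda>p. (h p, p)) ` In"
      "inj_on fst M" "inj_on snd M" "Out \<subseteq> Domain M" "In \<subseteq> Range M"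
    by blast
  have edge: "fst (ty (fst e)) \<and> \<not> fst (ty (snd e)) \<and> compatible (ty (fst e)) (ty (snd e)) \<and>
      fst e \<in> infrequent \<and> snd e \<in> infrequent" if "e \<in> M" for e
  proof -
    have stranded: "p \<in> infrequent" if "p \<in> stranded" for p using that by (simp add: stranded_def)
    consider (Out) p where "p \<in> Out" "e = (p, h p)" | (In) p where "p \<in> In" "e = (h p, p)"
      using \<open>e \<in> M\<close> M(1) by blast
    then show ?thesis
    proof cases
      case (Out p)
      then show ?thesis using h(2)[of p] stranded compatible_fst[of "ty p"] by (auto simp: Out_def)
    next
      case (In p)
      then show ?thesis
        using h(2)[of p] stranded compatible_fst[of "ty p" "ty (h p)"] compatible_sym[of "ty p"]
        by (auto simp: In_def)
    qed
  qed
  then have "\<forall>p\<in>Domain M. fst (ty p)" "\<forall>p\<in>Range M. \<not> fst (ty p)"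
    by (auto simp: Domain_fst Range_snd)
  then have "Domain M \<inter> Range M = {}" by blast
  then have "compatible_matching ty M"
    using M(2,3) edge by (simp add: compatible_matching_def matching_def)
  moreover have "stranded \<subseteq> Field M"
    using M(4,5) by (auto simp: Out_def In_def Field_def)
  moreover have "Field M \<subseteq> infrequent" using edge by (auto simp: Field_eq_images)
  ultimately show ?thesis by blast
qed

lemma ex_port_allocation:
  fixes U :: "'p set" and host :: "'p \<Rightarrow> 'c port_type"
  assumes U: "U \<subseteq> infrequent" and host: "host ` U \<subseteq> Fr" and par: "par ` Fr \<subseteq> Fr"
  obtains mate left right where
    "inj_on mate U" "inj_on left slots" "inj_on right slots"
    "mate ` U \<inter> left ` slots = {}" "mate ` U \<inter> right ` slots = {}"
    "left ` slots \<inter> right ` slots = {}"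
    "\<And>p. p \<in> U \<Longrightarrow> mate p \<in> ports_of P ty {host p}"
    "\<And>z. z \<in> slots \<Longrightarrow> left z \<in> ports_of P ty {fst z}"
    "\<And>z. z \<in> slots \<Longrightarrow> right z \<in> ports_of P ty {par (fst z)}"
proof -
  define D where "D = U <+> (slots <+> slots)"
  define request where
    "request = case_sum host (case_sum (\<lambda>(Q, _ :: nat). Q) (\<lambda>(Q, _ :: nat). par Q))"
  have finU: "finite U" using finite_infrequent U by (rule finite_subset[rotated])
  then have finD: "finite D" using finite_frequent by (simp add: D_def slots_def)
  have "card D = card U + card Fr * (2 * Suc k)"
    using finU finite_frequent by (simp add: D_def slots_def card_Plus card_cartesian_product)
  moreover have "request d \<in> Fr" if "d \<in> D" for d
    using that host par by (auto simp: D_def slots_def request_def)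
  ultimately have "\<exists>i. inj_on i D \<and> (\<forall>d\<in>D. i d \<in> {p \<in> P. ty p = request d})"
    using finD finite_ports card_mono[OF finite_infrequent U] card_frequent_ports
    by (intro distinct_representatives_of_large_sets) (fastforce simp: ports_of_def)+
  then obtain i where i: "inj_on i D" "\<And>d. d \<in> D \<Longrightarrow> i d \<in> ports_of P ty {request d}"
    by (auto simp: ports_of_def)
  have D: "Inl p \<in> D \<longleftrightarrow> p \<in> U" "Inr (Inl z) \<in> D \<longleftrightarrow> z \<in> slots"
    "Inr (Inr z) \<in> D \<longleftrightarrow> z \<in> slots" for p z
    by (auto simp: D_def)
  have i_eq: "i d = i d' \<longleftrightarrow> d = d'" if "d \<in> D" "d' \<in> D" for d d'
    using inj_on_eq_iff[OF i(1) that] .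
  show thesis
  proof (rule that[of "\<lambda>p. i (Inl p)" "\<lambda>z. i (Inr (Inl z))" "\<lambda>z. i (Inr (Inr z))"])
    show "inj_on (\<lambda>p. i (Inl p)) U" "inj_on (\<lambda>z. i (Inr (Inl z))) slots"
      "inj_on (\<lambda>z. i (Inr (Inr z))) slots"
      by (auto simp: inj_on_def i_eq D)
    show "(\<lambda>p. i (Inl p)) ` U \<inter> (\<lambda>z. i (Inr (Inl z))) ` slots = {}"
      "(\<lambda>p. i (Inl p)) ` U \<inter> (\<lambda>z. i (Inr (Inr z))) ` slots = {}"
      "(\<lambda>z. i (Inr (Inl z))) ` slots \<inter> (\<lambda>z. i (Inr (Inr z))) ` slots = {}"
      by (auto simp: i_eq D)
    show "i (Inl p) \<in> ports_of P ty {host p}" if "p \<in> U" for p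
      using i(2)[of "Inl p"] that by (simp add: D request_def)
    show "i (Inr (Inl z)) \<in> ports_of P ty {fst z}" "i (Inr (Inr z)) \<in> ports_of P ty {par (fst z)}"
      if "z \<in> slots" for z
      using i(2)[of "Inr (Inl z)"] i(2)[of "Inr (Inr z)"] that
      by (simp_all add: D request_def split_beta)
  qed
qed

lemma card_slot_pairs:
  assumes M: "finite M" "(\<lambda>z. (left z, right z)) ` slots \<subseteq> M" and inj: "inj_on left slots"
    and types: "\<And>z. z \<in> slots \<Longrightarrow> ty (left z) = fst z \<and> ty (right z) = par (fst z)"
    and Q: "Q \<in> Fr"
  shows "k < card (edges_between ty M Q (par Q))"
proof -
  have slot: "(Q, l) \<in> slots" if "l \<in> {..k}" for l using that Q by (simp add: slots_def)
  have "inj_on (\<lambda>l. (left (Q, l), right (Q, l))) {..k}"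
    using inj_onD[OF inj _ slot slot] by (auto simp: inj_on_def)
  moreover have "(\<lambda>l. (left (Q, l), right (Q, l))) ` {..k} \<subseteq> edges_between ty M Q (par Q)"
    using types[OF slot] slot M(2) by (auto simp: edges_between_def)
  moreover have "finite (edges_between ty M Q (par Q))" using M(1) by (simp add: edges_between_def)
  ultimately have "card {..k} \<le> card (edges_between ty M Q (par Q))" by (rule card_inj_on_le)
  then show ?thesis by simp
qed

lemma ex_matching_with_frequent:
  assumes U: "U \<subseteq> infrequent"
    and host: "\<And>p. p \<in> U \<Longrightarrow> host p \<in> Fr \<and> compatible (ty p) (host p)"
    and par: "\<And>Q. Q \<in> Fr \<Longrightarrow> par Q \<in> Fr \<and> compatible Q (par Q)"
  shows "\<exists>M. compatible_matching ty M \<and> U \<subseteq> Field M \<and> Field M \<subseteq> U \<union> ports_of P ty Fr \<and>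
    (\<forall>Q\<in>Fr. k < card (edges_between ty M Q (par Q)))"
proof -
  have "host ` U \<subseteq> Fr" "par ` Fr \<subseteq> Fr" using host par by blast+
  then obtain mate left right where
    inj: "inj_on mate U" "inj_on left slots" "inj_on right slots"
    and disjoint: "mate ` U \<inter> left ` slots = {}" "mate ` U \<inter> right ` slots = {}"
      "left ` slots \<inter> right ` slots = {}"
    and mate: "\<And>p. p \<in> U \<Longrightarrow> mate p \<in> ports_of P ty {host p}"
    and left: "\<And>z. z \<in> slots \<Longrightarrow> left z \<in> ports_of P ty {fst z}"
    and right: "\<And>z. z \<in> slots \<Longrightarrow> right z \<in> ports_of P ty {par (fst z)}"
    by (rule ex_port_allocation[OF U]) (rule that)
  have frequent: "mate ` U \<subseteq> ports_of P ty Fr" "left ` slots \<subseteq> ports_of P ty Fr"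
    "right ` slots \<subseteq> ports_of P ty Fr"
    using mate host left right par by (fastforce simp: ports_of_def slots_def)+
  define M1 where "M1 = (\<lambda>p. (p, mate p)) ` U"
  define M2 where "M2 = (\<lambda>z. (left z, right z)) ` slots"
  have Fields: "Field M1 = U \<union> mate ` U" "Field M2 = left ` slots \<union> right ` slots"
    unfolding M1_def M2_def Field_image_Pair by simp_all
  have U_disjoint: "U \<inter> X = {}" if "X \<subseteq> ports_of P ty Fr" for X
    using U that by (auto simp: ports_of_def)
  have "matching M1"
    using inj(1) U_disjoint[OF frequent(1)] matching_image_Pair[of "\<lambda>p. p"] by (simp add: M1_def)
  moreover have "matching M2"
    using inj(2,3) disjoint(3) by (simp add: M2_def matching_image_Pair)
  moreover have "compatible (ty (fst e)) (ty (snd e))" if "e \<in> M1 \<union> M2" for e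
    using that mate host left right par by (auto simp: M1_def M2_def slots_def ports_of_def)
  moreover have "Field M1 \<inter> Field M2 = {}"
    using disjoint(1,2) U_disjoint frequent
    by (simp add: Fields Int_Un_distrib Int_Un_distrib2)
  ultimately have "compatible_matching ty (M1 \<union> M2)"
    by (intro compatible_matching_Un) (simp_all add: compatible_matching_def)
  moreover have "U \<subseteq> Field (M1 \<union> M2)" "Field (M1 \<union> M2) \<subseteq> U \<union> ports_of P ty Fr"
    using frequent unfolding Field_Un Fields by auto
  moreover have "finite U" using finite_infrequent U by (rule finite_subset[rotated])
  then have "finite (M1 \<union> M2)" using finite_frequent by (simp add: M1_def M2_def slots_def)
  then have "k < card (edges_between ty (M1 \<union> M2) Q (par Q))" if "Q \<in> Fr" for Q
    using inj(2) left right that by (intro card_slot_pairs) (auto simp: M2_def ports_of_def)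
  ultimately show ?thesis by blast
qed

lemma ex_matching_infrequent:
  assumes par: "\<And>Q. Q \<in> Fr \<Longrightarrow> par Q \<in> Fr \<and> compatible Q (par Q)"
  shows "\<exists>M. compatible_matching ty M \<and> infrequent \<subseteq> Field M \<and> Field M \<subseteq> P \<and>
    (\<forall>Q\<in>Fr. k < card (edges_between ty M Q (par Q)))"
proof -
  obtain M where M: "compatible_matching ty M" "stranded \<subseteq> Field M" "Field M \<subseteq> infrequent"
    using ex_matching_stranded by blast
  define U where "U = infrequent - Field M"
  have U: "U \<subseteq> infrequent" "U \<inter> Field M = {}" by (auto simp: U_def)
  have "\<exists>Q\<in>Fr. compatible (ty p) Q" if "p \<in> U" for p
    using that M(2) by (auto simp: U_def stranded_def)
  then obtain host where host: "\<And>p. p \<in> U \<Longrightarrow> host p \<in> Fr \<and> compatible (ty p) (host p)"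
    by metis
  obtain N where N: "compatible_matching ty N" "U \<subseteq> Field N" "Field N \<subseteq> U \<union> ports_of P ty Fr"
      "\<And>Q. Q \<in> Fr \<Longrightarrow> k < card (edges_between ty N Q (par Q))"
    using ex_matching_with_frequent[of U host par] U(1) host par by blast
  have infrequent_disjoint: "infrequent \<inter> ports_of P ty Fr = {}" by (auto simp: ports_of_def)
  have "Field M \<inter> Field N = {}" using M(3) N(3) U(2) infrequent_disjoint by blast
  then have "compatible_matching ty (M \<union> N)" using M(1) N(1) by (intro compatible_matching_Un)
  moreover have "infrequent \<subseteq> Field (M \<union> N)" using N(2) by (auto simp: Field_Un U_def)
  moreover have Field_ports: "Field (M \<union> N) \<subseteq> P"
    using M(3) N(3) U(1) by (auto simp: Field_Un ports_of_def)
  moreover have "k < card (edges_between ty (M \<union> N) Q (par Q))" if "Q \<in> Fr" for Q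
  proof -
    have "M \<union> N \<subseteq> P \<times> P" using Field_ports by (auto simp: Field_eq_images)
    then have "finite (M \<union> N)" using finite_ports by (auto intro: finite_subset)
    then have "card (edges_between ty N Q (par Q)) \<le> card (edges_between ty (M \<union> N) Q (par Q))"
      by (intro card_mono) (auto simp: edges_between_def)
    then show ?thesis using N(4)[OF that] by simp
  qed
  ultimately show ?thesis by blast
qed

lemma ex_balanced_selection: "\<exists>s. balanced_selection P ty k s"
proof -
  obtain par where par: "\<And>Q. Q \<in> Fr \<Longrightarrow> par Q \<in> Fr \<and> compatible Q (par Q)"
    using ex_frequent_compatible by metis
  then obtain M where M: "compatible_matching ty M" "infrequent \<subseteq> Field M" "Field M \<subseteq> P"
      "\<And>Q. Q \<in> Fr \<Longrightarrow> k < card (edges_between ty M Q (par Q))"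
    using ex_matching_infrequent[of par] by blast
  have "ty p \<in> Fr" if "p \<in> P - Field M" for p
    using that M(2) by (auto simp: ports_of_def)
  then show ?thesis
    using ex_balanced_selection_of_matching[OF finite_ports M(1,3)] M(4) par by blast
qed

end

lemma ex_gap:
  fixes count :: "'a \<Rightarrow> nat" and threshold :: "nat \<Rightarrow> nat"
  assumes "finite A" "mono threshold"
  shows "\<exists>j \<le> card A. \<forall>x\<in>A. count x \<le> threshold j \<or> threshold (Suc j) < count x"
proof (rule ccontr)
  assume "\<not> ?thesis"
  then have "\<forall>j\<in>{..card A}. \<exists>x\<in>A. threshold j < count x \<and> count x \<le> threshold (Suc j)"
    by (meson atMost_iff not_le)
  then obtain x where x: "\<And>j. j \<le> card A \<Longrightarrow>
      x j \<in> A \<and> threshold j < count (x j) \<and> count (x j) \<le> threshold (Suc j)"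
    by (metis atMost_iff)
  have "x i \<noteq> x j" if "i < j" "j \<le> card A" for i j
    using x[of i] x[of j] that monoD[OF assms(2), of "Suc i" j] by force
  then have "inj_on x {..card A}"
    by (intro linorder_inj_onI) auto
  then have "card {..card A} \<le> card A"
    using x assms(1) by (metis atMost_iff card_inj_on_le image_subsetI)
  then show False by simp
qed

text \<open>Above a gap between two consecutive thresholds, each of the frequent types has more ports than
  all infrequent types together, with room for \<open>2 * Suc k\<close> extra ports per type.\<close>

fun threshold :: "nat \<Rightarrow> nat \<Rightarrow> nat \<Rightarrow> nat" where
  "threshold N k 0 = 0"
| "threshold N k (Suc j) = N * threshold N k j + 2 * N * Suc k"

definition accept_bound :: "nat \<Rightarrow> nat \<Rightarrow> nat" where
  "accept_bound N k = N * threshold N k N"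

lemma mono_threshold:
  assumes "1 \<le> N"
  shows "mono (threshold N k)"
proof (rule incseq_SucI)
  fix j
  have "threshold N k j \<le> N * threshold N k j" using assms by simp
  then show "threshold N k j \<le> threshold N k (Suc j)"
    unfolding threshold.simps by (rule trans_le_add1)
qed

lemma frequent_types_above_gap:
  assumes P: "finite P" and Ty: "finite Ty" "ty ` P \<subseteq> Ty"
    and gap: "\<And>Q. Q \<in> Ty \<Longrightarrow> card (ports_of P ty {Q}) \<le> t \<or>
      card Ty * t + 2 * card Ty * Suc k < card (ports_of P ty {Q})"
    and hall: "\<And>X. X \<subseteq> ty ` P \<Longrightarrow> card (nbr_ports P ty X) \<le> card Ty * t \<Longrightarrow>
      card (ports_of P ty X) \<le> card (nbr_ports P ty X)"
  shows "frequent_types P ty {Q \<in> Ty. t < card (ports_of P ty {Q})} k"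
proof -
  define Fr where "Fr = {Q \<in> Ty. t < card (ports_of P ty {Q})}"
  have "ports_of P ty (- Fr) = ports_of P ty (Ty - Fr)" using Ty(2) by (auto simp: ports_of_def)
  also have "card \<dots> \<le> card (Ty - Fr) * t"
    using Ty(1) by (intro card_ports_of_le) (auto simp: Fr_def)
  also have "\<dots> \<le> card Ty * t" using Ty(1) by (intro mult_le_mono1 card_mono) auto
  finally have "card (ports_of P ty (- Fr)) \<le> card Ty * t" .
  moreover have "card Fr \<le> card Ty" using Ty(1) by (intro card_mono) (auto simp: Fr_def)
  then have "card Fr * (2 * Suc k) \<le> card Ty * (2 * Suc k)" by (rule mult_le_mono1)
  ultimately have infrequent: "card (ports_of P ty (- Fr)) \<le> card Ty * t"
      "card (ports_of P ty (- Fr)) + card Fr * (2 * Suc k) \<le> card Ty * t + 2 * card Ty * Suc k"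
    by simp_all
  show ?thesis
    unfolding Fr_def[symmetric]
  proof
    show "finite Fr" using Ty(1) by (simp add: Fr_def)
    show "card (ports_of P ty (- Fr)) + card Fr * (2 * Suc k) \<le> card (ports_of P ty {Q})"
      if "Q \<in> Fr" for Q
      using gap[of Q] that infrequent(2) by (auto simp: Fr_def)
    show "card (ports_of P ty X) \<le> card (nbr_ports P ty X)"
      if "X \<subseteq> ty ` P" "nbr_ports P ty X \<subseteq> ports_of P ty (- Fr)" for X
    proof (rule hall[OF that(1)])
      have "finite (ports_of P ty (- Fr))" using P by (simp add: ports_of_def)
      then show "card (nbr_ports P ty X) \<le> card Ty * t"
        using card_mono[OF _ that(2)] infrequent(1) by linarith
    qed
  qed (rule P)
qed

lemma ex_deficient_type_set:
  fixes ty :: "'p \<Rightarrow> 'c port_type"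
  assumes P: "finite P" and Ty: "finite Ty" "Ty \<noteq> {}" "ty ` P \<subseteq> Ty"
    and unbalanced: "\<And>s. (\<And>p. p \<in> P \<Longrightarrow> s p \<in> snd (ty p)) \<Longrightarrow>
      \<exists>c. accept_count P s c < demand_count P s c \<and> accept_count P s c \<le> k"
  shows "\<exists>X\<subseteq>Ty. deficient P ty (accept_bound (card Ty) k) X"
proof (rule ccontr)
  assume not_deficient: "\<not> ?thesis"
  have mono: "mono (threshold (card Ty) k)"
    using Ty by (intro mono_threshold) (simp add: Suc_leI card_gt_0_iff)
  obtain j where j: "j \<le> card Ty" "\<And>Q. Q \<in> Ty \<Longrightarrow>
      card (ports_of P ty {Q}) \<le> threshold (card Ty) k j \<or>
      threshold (card Ty) k (Suc j) < card (ports_of P ty {Q})"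
    using ex_gap[OF Ty(1) mono, of "\<lambda>Q. card (ports_of P ty {Q})"] by blast
  have "frequent_types P ty {Q \<in> Ty. threshold (card Ty) k j < card (ports_of P ty {Q})} k"
  proof (rule frequent_types_above_gap[OF P Ty(1,3)])
    fix X assume X: "X \<subseteq> ty ` P" "card (nbr_ports P ty X) \<le> card Ty * threshold (card Ty) k j"
    have "card Ty * threshold (card Ty) k j \<le> accept_bound (card Ty) k"
      unfolding accept_bound_def using monoD[OF mono j(1)] by (rule mult_le_mono2)
    then have "card (nbr_ports P ty X) \<le> accept_bound (card Ty) k" using X(2) by linarith
    moreover have "X \<subseteq> Ty" using X(1) Ty(3) by blast
    ultimately show "card (ports_of P ty X) \<le> card (nbr_ports P ty X)"
      using not_deficient not_le unfolding deficient_def by blast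
  qed (use j(2) in simp)
  then obtain s where "balanced_selection P ty k s"
    using frequent_types.ex_balanced_selection by blast
  then show False using unbalanced[of s] unfolding balanced_selection_def by (metis not_le)
qed

subsection \<open>Port-numbered trees\<close>

text \<open>A tree is described from one of its nodes. The address of another node is the list of the ports
  taken on the way to it, and the tree maps this address to the port by which the node is entered.
  A branch stores its own entry port at \<open>[]\<close>; a whole tree stores there the non-port \<open>port_count\<close>.
  Addresses that walk back along an edge are mapped to \<open>0\<close>.\<close>

type_synonym ptree = "nat list \<Rightarrow> nat"

definition branch :: "ptree \<Rightarrow> nat \<Rightarrow> ptree" where
  "branch y p = (\<lambda>a. y (p # a))"

definition graft :: "ptree \<Rightarrow> nat \<Rightarrow> ptree \<Rightarrow> ptree" where
  "graft y p z = (\<lambda>a. case a of [] \<Rightarrow> y [] | r # b \<Rightarrow> if r = p then z b else y a)"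

definition agree :: "nat \<Rightarrow> ptree \<Rightarrow> ptree \<Rightarrow> bool" where
  "agree t x y \<longleftrightarrow> (\<forall>a. length a \<le> t \<longrightarrow> x a = y a)"

lemma branch_apply: "branch y p a = y (p # a)"
  by (simp add: branch_def)

lemma branch_Nil [simp]: "branch y p [] = y [p]"
  by (simp add: branch_def)

lemma branch_Cons [simp]: "branch y p (r # a) = y (p # r # a)"
  by (simp add: branch_def)

lemma graft_Nil [simp]: "graft y p z [] = y []"
  by (simp add: graft_def)

lemma graft_Cons [simp]: "graft y p z (r # b) = (if r = p then z b else y (r # b))"
  by (simp add: graft_def)

lemma branch_graft [simp]: "branch (graft y p z) r = (if r = p then z else branch y r)"
  by (auto simp: fun_eq_iff branch_apply)

lemma ptree_eqI:
  assumes "x [] = y []" "\<And>p. branch x p = branch y p"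
  shows "x = y"
proof
  fix a
  show "x a = y a" using assms by (cases a) (simp_all flip: branch_apply)
qed

lemma agree_refl [simp]: "agree t x x"
  by (simp add: agree_def)

lemma agree_sym: "agree t x y \<Longrightarrow> agree t y x"
  by (simp add: agree_def)

lemma agree_trans: "agree t x y \<Longrightarrow> agree t y z \<Longrightarrow> agree t x z"
  by (simp add: agree_def)

lemma agree_0 [simp]: "agree 0 x y \<longleftrightarrow> x [] = y []"
  by (simp add: agree_def)

lemma agree_mono: "agree t x y \<Longrightarrow> s \<le> t \<Longrightarrow> agree s x y"
  by (simp add: agree_def)

lemma agree_Suc: "agree (Suc t) x y \<longleftrightarrow> x [] = y [] \<and> (\<forall>p. agree t (branch x p) (branch y p))"
proof
  assume branches: "x [] = y [] \<and> (\<forall>p. agree t (branch x p) (branch y p))"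
  have "x a = y a" if "length a \<le> Suc t" for a
    using that branches by (cases a) (auto simp: agree_def branch_apply)
  then show "agree (Suc t) x y" by (simp add: agree_def)
qed (auto simp: agree_def branch_apply)

locale ported_trees =
  fixes m :: nat
begin

definition port_count :: nat where "port_count = 2 * m + 1"

text \<open>Edges are oriented: the ports \<open>p \<le> m\<close> are outgoing, the others are incoming.\<close>

definition opposite :: "nat \<Rightarrow> nat \<Rightarrow> bool" where
  "opposite p q \<longleftrightarrow> p < port_count \<and> q < port_count \<and> (p \<le> m) \<noteq> (q \<le> m)"

lemma opposite_sym: "opposite p q \<Longrightarrow> opposite q p"
  by (auto simp: opposite_def)

lemma opposite_less: "opposite p q \<Longrightarrow> p < port_count" "opposite p q \<Longrightarrow> q < port_count"
  by (auto simp: opposite_def)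

lemma card_opposite:
  assumes "p < port_count"
  shows "m \<le> card {q. opposite p q}"
proof (cases "p \<le> m")
  case True
  then have "{q. opposite p q} = {m<..<port_count}" using assms by (auto simp: opposite_def)
  then show ?thesis by (simp add: port_count_def)
next
  case False
  then have "{q. opposite p q} = {..m}" using assms by (auto simp: opposite_def port_count_def)
  then show ?thesis by simp
qed

definition exits :: "ptree \<Rightarrow> nat set" where
  "exits y = {..<port_count} - {y []}"

lemma finite_exits [simp]: "finite (exits y)"
  by (simp add: exits_def)

fun reduced :: "ptree \<Rightarrow> nat list \<Rightarrow> bool" where
  "reduced y [] = True"
| "reduced y (p # a) = (p \<in> exits y \<and> reduced (branch y p) a)"

coinductive valid_branch :: "ptree \<Rightarrow> bool" where
  "\<lbrakk>\<And>p. p \<in> exits y \<Longrightarrow> opposite p (y [p]) \<and> valid_branch (branch y p);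
    \<And>p. p \<notin> exits y \<Longrightarrow> branch y p = (\<lambda>_. 0)\<rbrakk> \<Longrightarrow> valid_branch y"

lemma valid_branch_iff:
  "valid_branch y \<longleftrightarrow> (\<forall>p\<in>exits y. opposite p (y [p]) \<and> valid_branch (branch y p)) \<and>
     (\<forall>p. p \<notin> exits y \<longrightarrow> branch y p = (\<lambda>_. 0))"
  by (subst valid_branch.simps) auto

lemma valid_branch_exitD:
  "valid_branch y \<Longrightarrow> p \<in> exits y \<Longrightarrow> opposite p (y [p]) \<and> valid_branch (branch y p)"
  by (subst (asm) valid_branch_iff) blast

lemma valid_branch_not_exitD: "valid_branch y \<Longrightarrow> p \<notin> exits y \<Longrightarrow> branch y p = (\<lambda>_. 0)"
  by (subst (asm) valid_branch_iff) blast

lemma opposite_entry: "valid_branch y \<Longrightarrow> reduced y a \<Longrightarrow> a \<noteq> [] \<Longrightarrow> opposite (last a) (y a)"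
proof (induction a arbitrary: y)
  case (Cons p a)
  then have p: "opposite p (y [p])" "valid_branch (branch y p)"
    using valid_branch_exitD[of y p] by simp_all
  then show ?case
    using Cons.IH[of "branch y p"] Cons.prems by (cases "a = []") (simp_all add: branch_def)
qed simp

lemma not_reduced_entry: "valid_branch y \<Longrightarrow> \<not> reduced y a \<Longrightarrow> y a = 0"
proof (induction a arbitrary: y)
  case (Cons p a)
  show ?case
  proof (cases "p \<in> exits y")
    case True
    then show ?thesis
      using Cons.IH[of "branch y p"] Cons.prems valid_branch_exitD[of y p] by (simp add: branch_def)
  next
    case False
    then show ?thesis
      using fun_cong[OF valid_branch_not_exitD[OF Cons.prems(1)], of p a]
      by (simp add: branch_apply)
  qed
qed simp

definition valid_tree :: "ptree \<Rightarrow> bool" where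
  "valid_tree x \<longleftrightarrow> x [] = port_count \<and> valid_branch x"

lemma valid_tree_Nil: "valid_tree x \<Longrightarrow> x [] = port_count"
  by (simp add: valid_tree_def)

lemma exits_valid_tree: "valid_tree x \<Longrightarrow> exits x = {..<port_count}"
  by (auto simp: exits_def valid_tree_Nil)

lemma valid_tree_iff:
  "valid_tree x \<longleftrightarrow> x [] = port_count \<and>
     (\<forall>p<port_count. opposite p (x [p]) \<and> valid_branch (branch x p)) \<and>
     (\<forall>p\<ge>port_count. branch x p = (\<lambda>_. 0))"
  unfolding valid_tree_def by (subst valid_branch_iff) (auto simp: exits_def not_less)

lemma valid_tree_opposite: "valid_tree x \<Longrightarrow> p < port_count \<Longrightarrow> opposite p (x [p])"
  by (simp add: valid_tree_iff)

lemma valid_tree_entry_less: "valid_tree x \<Longrightarrow> p < port_count \<Longrightarrow> x [p] < port_count"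
  using valid_tree_opposite opposite_less(2) by blast

lemma valid_tree_branch: "valid_tree x \<Longrightarrow> p < port_count \<Longrightarrow> valid_branch (branch x p)"
  by (simp add: valid_tree_iff)

lemma entry_less:
  assumes "valid_tree x" "reduced x a" "a \<noteq> []"
  shows "x a < port_count"
  using opposite_entry[of x a] assms opposite_less(2) by (auto simp: valid_tree_def)

definition cut :: "ptree \<Rightarrow> nat \<Rightarrow> ptree" where
  "cut x p = graft (x([] := p)) p (\<lambda>_. 0)"

definition reroot :: "ptree \<Rightarrow> nat \<Rightarrow> ptree" where
  "reroot x p = graft ((branch x p)([] := port_count)) (x [p]) (cut x p)"

lemma cut_Nil [simp]: "cut x p [] = p"
  by (simp add: cut_def)

lemma cut_Cons [simp]: "cut x p (r # a) = (if r = p then 0 else x (r # a))"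
  by (simp add: cut_def)

lemma branch_cut: "branch (cut x p) r = (if r = p then (\<lambda>_. 0) else branch x r)"
  by (auto simp: fun_eq_iff branch_apply)

lemma reroot_Nil [simp]: "reroot x p [] = port_count"
  by (simp add: reroot_def)

lemma reroot_Cons: "reroot x p (r # a) = (if r = x [p] then cut x p a else x (p # r # a))"
  by (simp add: reroot_def)

lemma branch_reroot:
  "branch (reroot x p) r = (if r = x [p] then cut x p else branch (branch x p) r)"
  by (auto simp: fun_eq_iff branch_apply reroot_Cons)

lemma reroot_back [simp]: "reroot x p [x [p]] = p"
  by (simp add: reroot_Cons)

lemma valid_branch_cut:
  assumes "valid_tree x"
  shows "valid_branch (cut x p)"
  using assms unfolding valid_branch_iff[of "cut x p"] valid_tree_iff
  by (auto simp: exits_def branch_cut)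

lemma valid_tree_reroot:
  assumes x: "valid_tree x" and p: "p < port_count"
  shows "valid_tree (reroot x p)"
  unfolding valid_tree_iff
proof (intro conjI allI impI)
  have y: "valid_branch (branch x p)" and opp: "opposite p (x [p])"
    using x p unfolding valid_tree_iff by auto
  fix r
  show "opposite r (reroot x p [r])" "valid_branch (branch (reroot x p) r)" if "r < port_count"
    using opp valid_branch_exitD[OF y, of r] valid_branch_cut[OF x] that
    by (auto simp: reroot_Cons branch_reroot opposite_sym exits_def)
  show "branch (reroot x p) r = (\<lambda>_. 0)" if "port_count \<le> r"
    using opposite_less(2)[OF opp] valid_branch_not_exitD[OF y, of r] that
    by (auto simp: branch_reroot exits_def)
qed simp

lemma reroot_reroot:
  assumes x: "valid_tree x" and p: "p < port_count"
  shows "reroot (reroot x p) (x [p]) = x"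
proof (rule ptree_eqI)
  show "reroot (reroot x p) (x [p]) [] = x []" using valid_tree_Nil[OF x] by simp
  have no_return: "branch (branch x p) (x [p]) = (\<lambda>_. 0)"
    using valid_branch_not_exitD[OF valid_tree_branch[OF x p]] by (simp add: exits_def)
  have "cut (reroot x p) (x [p]) = branch x p"
    by (rule ptree_eqI) (auto simp: branch_cut branch_reroot no_return)
  then show "branch (reroot (reroot x p) (x [p])) r = branch x r" for r
    by (simp add: branch_reroot branch_cut)
qed

text \<open>The edge view of radius \<open>t\<close> consists of the radius-\<open>t\<close> neighborhoods of the root and of its
  neighbor at port \<open>p\<close>.\<close>

definition edge_agree :: "nat \<Rightarrow> nat \<Rightarrow> ptree \<Rightarrow> ptree \<Rightarrow> bool" where
  "edge_agree t p x y \<longleftrightarrow> agree t x y \<and> agree t (branch x p) (branch y p)"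

lemma edge_agree_sym: "edge_agree t p x y \<Longrightarrow> edge_agree t p y x"
  by (auto simp: edge_agree_def agree_sym)

lemma edge_agree_trans: "edge_agree t p x y \<Longrightarrow> edge_agree t p y z \<Longrightarrow> edge_agree t p x z"
  by (auto simp: edge_agree_def intro: agree_trans)

lemma edge_agree_port: "edge_agree t p x y \<Longrightarrow> x [p] = y [p]"
  unfolding edge_agree_def agree_def by (metis le0 list.size(3) branch_apply)

lemma agree_cut: "agree t x y \<Longrightarrow> agree t (cut x p) (cut y p)"
  unfolding agree_def
proof (intro allI impI)
  fix a :: "nat list" assume "\<forall>a. length a \<le> t \<longrightarrow> x a = y a" "length a \<le> t"
  then show "cut x p a = cut y p a" by (cases a) auto
qed

lemma agree_reroot:
  assumes "edge_agree t p x y"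
  shows "agree t (reroot x p) (reroot y p)"
  unfolding agree_def
proof (intro allI impI)
  fix a :: "nat list" assume a: "length a \<le> t"
  show "reroot x p a = reroot y p a"
  proof (cases a)
    case (Cons r b)
    have "cut x p b = cut y p b"
      using agree_cut[of t x y p] assms a Cons by (auto simp: edge_agree_def agree_def)
    moreover have "x (p # r # b) = y (p # r # b)"
      using assms a Cons by (auto simp: edge_agree_def agree_def branch_apply)
    ultimately show ?thesis using Cons edge_agree_port[OF assms] by (simp add: reroot_Cons)
  qed simp
qed

lemma edge_agree_reroot:
  assumes "edge_agree t p x y"
  shows "edge_agree t (x [p]) (reroot x p) (reroot y p)"
proof -
  have "agree t (cut x p) (cut y p)" using assms by (simp add: edge_agree_def agree_cut)
  then show ?thesis
    using agree_reroot[OF assms] edge_agree_port[OF assms]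
    by (simp add: edge_agree_def branch_reroot)
qed

lemma agree_reroot_Suc:
  assumes "agree (Suc t) x y"
  shows "agree t (reroot x p) (reroot y p)"
proof (rule agree_reroot)
  show "edge_agree t p x y"
    using assms agree_mono[OF assms, of t] unfolding edge_agree_def agree_Suc by simp
qed

definition splice :: "ptree \<Rightarrow> nat \<Rightarrow> ptree \<Rightarrow> ptree" where
  "splice x p y = graft x p (branch y p)"

lemma splice_port [simp]: "splice x p y [p] = y [p]"
  by (simp add: splice_def)

lemma valid_tree_splice: "valid_tree x \<Longrightarrow> valid_tree y \<Longrightarrow> valid_tree (splice x p y)"
  by (simp add: valid_tree_iff splice_def)

lemma agree_splice: "edge_agree t p x y \<Longrightarrow> agree (Suc t) (splice x p y) x"
  by (auto simp: agree_Suc edge_agree_def splice_def agree_sym)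

lemma agree_reroot_splice:
  assumes "edge_agree t p x y"
  shows "agree (Suc t) (reroot (splice x p y) p) (reroot y p)"
proof -
  have "agree t (cut x p) (cut y p)" using assms by (simp add: edge_agree_def agree_cut)
  moreover have "cut (splice x p y) p = cut x p"
    by (rule ptree_eqI) (simp_all add: branch_cut splice_def)
  ultimately show ?thesis by (auto simp: agree_Suc branch_reroot) (simp add: splice_def)
qed

definition assemble :: "(nat \<Rightarrow> ptree) \<Rightarrow> ptree" where
  "assemble y = (\<lambda>a. case a of [] \<Rightarrow> port_count | p # b \<Rightarrow> if p < port_count then y p a else 0)"

lemma assemble_Nil [simp]: "assemble y [] = port_count"
  by (simp add: assemble_def)

lemma assemble_Cons [simp]: "assemble y (p # a) = (if p < port_count then y p (p # a) else 0)"
  by (simp add: assemble_def)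

lemma branch_assemble:
  "branch (assemble y) p = (if p < port_count then branch (y p) p else (\<lambda>_. 0))"
  by (auto simp: fun_eq_iff branch_apply)

lemma valid_tree_assemble:
  assumes "\<And>p. p < port_count \<Longrightarrow> valid_tree (y p)"
  shows "valid_tree (assemble y)"
  using assms unfolding valid_tree_iff by (simp add: branch_assemble)

lemma agree_assemble:
  assumes x: "valid_tree x" and y: "\<And>p. p < port_count \<Longrightarrow> agree t x (y p)"
  shows "agree t (assemble y) x"
  unfolding agree_def
proof (intro allI impI)
  fix a :: "nat list" assume a: "length a \<le> t"
  show "assemble y a = x a"
  proof (cases a)
    case Nil
    then show ?thesis using valid_tree_Nil[OF x] by simp
  next
    case (Cons p b)
    have "x (p # b) = 0" if "port_count \<le> p"
      using x that unfolding valid_tree_iff by (metis branch_apply)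
    then show ?thesis using y a Cons by (auto simp: agree_def)
  qed
qed

fun default_branch :: "nat \<Rightarrow> ptree" where
  "default_branch q [] = q"
| "default_branch q (p # a) =
    (if p < port_count \<and> p \<noteq> q then default_branch (if p \<le> m then 2 * m else 0) a else 0)"

lemma branch_default_branch:
  "branch (default_branch q) p =
    (if p < port_count \<and> p \<noteq> q then default_branch (if p \<le> m then 2 * m else 0) else (\<lambda>_. 0))"
  by (rule ext) (simp add: branch_apply)

lemma valid_branch_default_branch:
  assumes "0 < m"
  shows "valid_branch (default_branch q)"
proof (coinduction arbitrary: q)
  case valid_branch
  show ?case
    using assms by (auto simp: branch_default_branch exits_def opposite_def port_count_def)
qed

lemma ex_valid_tree:
  assumes "0 < m" "opposite p q"
  shows "\<exists>x. valid_tree x \<and> x [p] = q"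
proof (intro exI conjI)
  have "valid_tree (default_branch port_count)"
    unfolding valid_tree_def using valid_branch_default_branch[OF assms(1)] by simp
  then show "valid_tree (graft (default_branch port_count) p (default_branch q))"
    using valid_branch_default_branch[OF assms(1), of q] assms(2) opposite_less[OF assms(2)]
    unfolding valid_tree_iff by auto
qed simp

end

subsection \<open>Superweak colorings and round elimination\<close>

text \<open>The outputs of a node are functions of the tree seen from that node.\<close>

locale superweak_coloring = ported_trees m for m :: nat +
  fixes t k :: nat and col :: "ptree \<Rightarrow> nat" and demands accepts :: "ptree \<Rightarrow> nat set"
  assumes col_cong: "\<And>x y. valid_tree x \<Longrightarrow> valid_tree y \<Longrightarrow> agree t x y \<Longrightarrow> col x = col y"
    and demands_cong:
      "\<And>x y. valid_tree x \<Longrightarrow> valid_tree y \<Longrightarrow> agree t x y \<Longrightarrow> demands x = demands y"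
    and accepts_cong:
      "\<And>x y. valid_tree x \<Longrightarrow> valid_tree y \<Longrightarrow> agree t x y \<Longrightarrow> accepts x = accepts y"
    and col_less: "\<And>x. valid_tree x \<Longrightarrow> col x < k"
    and demands_subset: "\<And>x. valid_tree x \<Longrightarrow> demands x \<subseteq> {..<port_count}"
    and accepts_subset: "\<And>x. valid_tree x \<Longrightarrow> accepts x \<subseteq> {..<port_count}"
    and card_accepts_less: "\<And>x. valid_tree x \<Longrightarrow> card (accepts x) < card (demands x)"
    and card_accepts_le: "\<And>x. valid_tree x \<Longrightarrow> card (accepts x) \<le> k"
    and demand_accepted: "\<And>x p. valid_tree x \<Longrightarrow> p \<in> demands x \<Longrightarrow> col (reroot x p) = col x \<Longrightarrow>
      x [p] \<in> accepts (reroot x p)"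

definition superweak_colorable :: "nat \<Rightarrow> nat \<Rightarrow> nat \<Rightarrow> bool" where
  "superweak_colorable m t k \<longleftrightarrow> (\<exists>col demands accepts. superweak_coloring m t k col demands accepts)"

lemma not_superweak_colorable_0:
  assumes m: "0 < m" and k: "k < m"
  shows "\<not> superweak_colorable m 0 k"
proof
  assume "superweak_colorable m 0 k"
  then obtain col demands accepts where "superweak_coloring m 0 k col demands accepts"
    unfolding superweak_colorable_def by blast
  then interpret superweak_coloring m 0 k col demands accepts .
  have agree: "agree 0 x y" if "valid_tree x" "valid_tree y" for x y
    using that by (simp add: valid_tree_Nil)
  have "opposite 0 (2 * m)" using m by (auto simp: opposite_def port_count_def)
  then obtain x where x: "valid_tree x" using ex_valid_tree m by blast
  have "demands x \<noteq> {}" using card_accepts_less[OF x] by auto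
  then obtain p where p: "p \<in> demands x" by blast
  then have p_less: "p < port_count" using demands_subset[OF x] by auto
  have "{q. opposite p q} \<subseteq> accepts x"
  proof
    fix q assume "q \<in> {q. opposite p q}"
    then obtain y where y: "valid_tree y" "y [p] = q" using ex_valid_tree m by blast
    have r: "valid_tree (reroot y p)" using valid_tree_reroot[OF y(1) p_less] .
    have "p \<in> demands y" using demands_cong[OF y(1) x agree] y(1) x p by simp
    moreover have "col (reroot y p) = col y" using col_cong[OF r y(1) agree] r y(1) by simp
    ultimately have "q \<in> accepts (reroot y p)" using demand_accepted[OF y(1)] y(2) by blast
    then show "q \<in> accepts x" using accepts_cong[OF r x agree] r x by simp
  qed
  moreover have "finite (accepts x)" using accepts_subset[OF x] finite_subset by blast
  ultimately have "card {q. opposite p q} \<le> card (accepts x)" by (rule card_mono[rotated])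
  then show False using card_opposite[OF p_less] card_accepts_le[OF x] k by linarith
qed

locale speedup = superweak_coloring m "Suc t" k col demands accepts
  for m t k col demands accepts
begin

text \<open>Given the edge view of radius \<open>t\<close>, these are the colors with which the node, respectively its
  neighbor, may still demand along the edge. If the node takes a blocked color it must accept.\<close>

definition demand_colors :: "ptree \<Rightarrow> nat \<Rightarrow> nat set" where
  "demand_colors x p = {c. \<exists>y. valid_tree y \<and> edge_agree t p y x \<and> col y = c \<and> p \<in> demands y}"

definition blocked_colors :: "ptree \<Rightarrow> nat \<Rightarrow> nat set" where
  "blocked_colors x p = demand_colors (reroot x p) (x [p])"

definition port_type :: "ptree \<Rightarrow> nat \<Rightarrow> nat port_type" where
  "port_type x p =
     (p \<le> m, {(demand_colors y p, blocked_colors y p) |y. valid_tree y \<and> agree t x y})"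

definition all_types :: "nat port_type set" where
  "all_types = UNIV \<times> Pow (Pow {..<k} \<times> Pow {..<k})"

lemma demand_colors_cong:
  assumes "edge_agree t p x y"
  shows "demand_colors x p = demand_colors y p"
proof -
  have "edge_agree t p z x \<longleftrightarrow> edge_agree t p z y" for z
    using assms edge_agree_trans edge_agree_sym by blast
  then show ?thesis unfolding demand_colors_def by simp
qed

lemma blocked_colors_cong:
  assumes "edge_agree t p x y"
  shows "blocked_colors x p = blocked_colors y p"
  using demand_colors_cong[OF edge_agree_reroot[OF assms]] edge_agree_port[OF assms]
  by (simp add: blocked_colors_def)

lemma demand_colors_subset: "demand_colors x p \<subseteq> {..<k}"
  using col_less by (auto simp: demand_colors_def)

lemma blocked_colors_reroot:
  assumes "valid_tree x" "p < port_count"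
  shows "blocked_colors (reroot x p) (x [p]) = demand_colors x p"
  unfolding blocked_colors_def using reroot_reroot[OF assms] by simp

lemma finite_all_types: "finite all_types"
  unfolding all_types_def by simp

lemma card_all_types: "card all_types = 2 * 2 ^ (2 ^ k * 2 ^ k)"
  unfolding all_types_def by (simp add: card_cartesian_product card_Pow)

lemma port_type_in_all_types: "port_type x p \<in> all_types"
  using demand_colors_subset unfolding port_type_def all_types_def blocked_colors_def by auto

lemma port_type_cong:
  assumes "agree t x y"
  shows "port_type x = port_type y"
proof -
  have "agree t x z \<longleftrightarrow> agree t y z" for z
    using assms agree_trans agree_sym by blast
  then show ?thesis unfolding port_type_def by simp
qed

lemma demand_colorsI: "valid_tree x \<Longrightarrow> p \<in> demands x \<Longrightarrow> col x \<in> demand_colors x p"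
  unfolding demand_colors_def edge_agree_def by auto

text \<open>The radius-\<open>(t + 1)\<close> neighborhoods of the two endpoints of an edge with a fixed edge view of
  radius \<open>t\<close> can be chosen independently of each other, by splicing two trees along the edge.\<close>

lemma accepts_if_blocked_color:
  assumes x: "valid_tree x" and p: "p < port_count" and blocked: "col x \<in> blocked_colors x p"
  shows "p \<in> accepts x"
proof -
  let ?q = "x [p]"
  have q: "?q < port_count" using valid_tree_entry_less[OF x p] .
  obtain z where z: "valid_tree z" "edge_agree t ?q z (reroot x p)" "col z = col x" "?q \<in> demands z"
    using blocked unfolding blocked_colors_def demand_colors_def by blast
  define y where "y = reroot z ?q"
  have zq: "z [?q] = p" using edge_agree_port[OF z(2)] by simp
  have y: "valid_tree y" unfolding y_def using valid_tree_reroot[OF z(1) q] .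
  have yz: "reroot y p = z" unfolding y_def using reroot_reroot[OF z(1) q] zq by simp
  have yp: "y [p] = ?q" unfolding y_def using reroot_back[of z ?q] zq by simp
  have xy: "edge_agree t p x y"
    using edge_agree_reroot[OF z(2)] reroot_reroot[OF x p] zq edge_agree_sym unfolding y_def by simp
  define w where "w = splice x p y"
  have w: "valid_tree w" unfolding w_def using valid_tree_splice[OF x y] .
  have wq: "w [p] = ?q" unfolding w_def using yp by simp
  have r: "valid_tree (reroot w p)" using valid_tree_reroot[OF w p] .
  have wx: "agree (Suc t) w x" unfolding w_def using agree_splice[OF xy] .
  have rz: "agree (Suc t) (reroot w p) z"
    unfolding w_def using agree_reroot_splice[OF xy] yz by simp
  have "?q \<in> demands (reroot w p)" using demands_cong[OF r z(1) rz] z(4) by simp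
  moreover have "col (reroot (reroot w p) ?q) = col (reroot w p)"
    using reroot_reroot[OF w p] wq col_cong[OF w x wx] col_cong[OF r z(1) rz] z(3) by simp
  ultimately have "reroot w p [?q] \<in> accepts (reroot (reroot w p) ?q)"
    using demand_accepted[OF r] by blast
  then show ?thesis
    using reroot_reroot[OF w p] wq accepts_cong[OF w x wx] reroot_back[of w p] by simp
qed

lemma ex_deficient_types:
  assumes x: "valid_tree x"
  shows "\<exists>X\<subseteq>all_types.
    deficient {..<port_count} (port_type x) (accept_bound (card all_types) k) X"
proof (rule ex_deficient_type_set)
  show "all_types \<noteq> {}" using port_type_in_all_types by blast
  show "port_type x ` {..<port_count} \<subseteq> all_types" using port_type_in_all_types by blast
  fix s assume s: "\<And>p. p \<in> {..<port_count} \<Longrightarrow> s p \<in> snd (port_type x p)"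
  have "\<exists>y. valid_tree y \<and> agree t x y \<and> s p = (demand_colors y p, blocked_colors y p)"
    if "p < port_count" for p
    using s[of p] that unfolding port_type_def by auto
  then obtain y where y: "\<And>p. p < port_count \<Longrightarrow> valid_tree (y p) \<and> agree t x (y p) \<and>
      s p = (demand_colors (y p) p, blocked_colors (y p) p)"
    by metis
  define w where "w = assemble y"
  have w: "valid_tree w" unfolding w_def using y by (intro valid_tree_assemble) blast
  have wx: "agree t w x" unfolding w_def using x y by (intro agree_assemble) blast+
  have s_eq: "s p = (demand_colors w p, blocked_colors w p)" if p: "p < port_count" for p
  proof -
    have "agree t w (y p)" using y[OF p] wx agree_trans by blast
    then have "edge_agree t p w (y p)" using p by (simp add: edge_agree_def w_def branch_assemble)
    then show ?thesis using demand_colors_cong blocked_colors_cong y[OF p] by metis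
  qed
  have "demands w \<subseteq> {p \<in> {..<port_count}. col w \<in> fst (s p)}"
    using demands_subset[OF w] demand_colorsI[OF w] s_eq by fastforce
  then have "card (demands w) \<le> demand_count {..<port_count} s (col w)"
    unfolding demand_count_def by (intro card_mono) auto
  moreover have "{p \<in> {..<port_count}. col w \<in> snd (s p)} \<subseteq> accepts w"
    using accepts_if_blocked_color[OF w] s_eq by auto
  then have "accept_count {..<port_count} s (col w) \<le> card (accepts w)"
    unfolding accept_count_def using accepts_subset[OF w] finite_subset by (intro card_mono) auto
  ultimately show "\<exists>c. accept_count {..<port_count} s c < demand_count {..<port_count} s c \<and>
      accept_count {..<port_count} s c \<le> k"
    using card_accepts_less[OF w] card_accepts_le[OF w] by (intro exI[of _ "col w"]) linarith
qed (simp_all add: finite_all_types)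

lemma compatible_across_edge:
  assumes x: "valid_tree x" and p: "p < port_count"
  shows "compatible (port_type x p) (port_type (reroot x p) (x [p]))"
proof -
  let ?r = "reroot x p" and ?q = "x [p]"
  have "fst (port_type x p) \<noteq> fst (port_type ?r ?q)"
    using valid_tree_opposite[OF x p] by (simp add: opposite_def port_type_def)
  moreover have "(demand_colors x p, blocked_colors x p) \<in> snd (port_type x p)"
    unfolding port_type_def using x by auto
  moreover have "(demand_colors ?r ?q, blocked_colors ?r ?q) \<in> snd (port_type ?r ?q)"
    unfolding port_type_def using valid_tree_reroot[OF x p] by auto
  then have "(blocked_colors x p, demand_colors x p) \<in> snd (port_type ?r ?q)"
    unfolding blocked_colors_reroot[OF x p] blocked_colors_def[of x p] .
  ultimately show ?thesis unfolding compatible_def by blast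
qed

definition type_choice :: "ptree \<Rightarrow> nat port_type set" where
  "type_choice x = (SOME X. X \<subseteq> all_types \<and>
     deficient {..<port_count} (port_type x) (accept_bound (card all_types) k) X)"

lemma type_choice:
  assumes "valid_tree x"
  shows "type_choice x \<subseteq> all_types"
    and "deficient {..<port_count} (port_type x) (accept_bound (card all_types) k) (type_choice x)"
proof -
  have "type_choice x \<subseteq> all_types \<and>
      deficient {..<port_count} (port_type x) (accept_bound (card all_types) k) (type_choice x)"
    unfolding type_choice_def using ex_deficient_types[OF assms] by (rule someI_ex)
  then show "type_choice x \<subseteq> all_types"
    "deficient {..<port_count} (port_type x) (accept_bound (card all_types) k) (type_choice x)"
    by auto
qed

definition new_demands :: "ptree \<Rightarrow> nat set" where
  "new_demands x = ports_of {..<port_count} (port_type x) (type_choice x)"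

definition new_accepts :: "ptree \<Rightarrow> nat set" where
  "new_accepts x = nbr_ports {..<port_count} (port_type x) (type_choice x)"

text \<open>The types at the two ends of an edge are always compatible, so a demand between nodes that choose
  the same deficient set of types is accepted.\<close>

lemma superweak_colorable_one_round_less:
  assumes "2 ^ card all_types \<le> k'" "accept_bound (card all_types) k \<le> k'"
  shows "superweak_colorable m t k'"
proof -
  obtain enc where enc: "bij_betw enc (Pow all_types) {0..<card (Pow all_types)}"
    using ex_bij_betw_finite_nat[of "Pow all_types"] finite_all_types by auto
  have choice_cong: "type_choice x = type_choice y" if "agree t x y" for x y
    using port_type_cong[OF that] by (simp add: type_choice_def)
  have "superweak_coloring m t k' (\<lambda>x. enc (type_choice x)) new_demands new_accepts"
  proof
    fix x y assume xy: "agree t x y"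
    show "enc (type_choice x) = enc (type_choice y)" using choice_cong[OF xy] by simp
    show "new_demands x = new_demands y" "new_accepts x = new_accepts y"
      using choice_cong[OF xy] port_type_cong[OF xy]
      by (simp_all add: new_demands_def new_accepts_def)
  next
    fix x assume x: "valid_tree x"
    have "enc (type_choice x) \<in> {0..<card (Pow all_types)}"
      using bij_betwE[OF enc] type_choice(1)[OF x] by blast
    then show "enc (type_choice x) < k'" using assms(1) by (simp add: card_Pow finite_all_types)
    show "new_demands x \<subseteq> {..<port_count}" "new_accepts x \<subseteq> {..<port_count}"
      by (auto simp: new_demands_def new_accepts_def ports_of_def nbr_ports_def)
    show "card (new_accepts x) < card (new_demands x)" "card (new_accepts x) \<le> k'"
      using type_choice(2)[OF x] assms(2)
      by (simp_all add: deficient_def new_demands_def new_accepts_def)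
  next
    fix x p
    assume x: "valid_tree x" and p: "p \<in> new_demands x"
      and "enc (type_choice (reroot x p)) = enc (type_choice x)"
    have p_less: "p < port_count" using p by (simp add: new_demands_def ports_of_def)
    have "type_choice (reroot x p) = type_choice x"
      using inj_onD[OF bij_betw_imp_inj_on[OF enc] \<open>enc _ = enc _\<close>] x p_less
      by (simp add: type_choice(1) valid_tree_reroot)
    then have "port_type x p \<in> type_choice (reroot x p)"
      using p by (simp add: new_demands_def ports_of_def)
    then show "x [p] \<in> new_accepts (reroot x p)"
      using compatible_across_edge[OF x p_less] valid_tree_entry_less[OF x p_less]
      by (auto simp: new_accepts_def nbr_ports_def)
  qed
  then show ?thesis unfolding superweak_colorable_def by blast
qed

end

subsection \<open>Tower bounds\<close>

primrec tower :: "nat \<Rightarrow> nat" where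
  "tower 0 = 1"
| "tower (Suc n) = 2 ^ tower n"

lemma tower_pos: "1 \<le> tower n"
  by (induction n) auto

lemma strict_mono_tower: "strict_mono tower"
  by (simp add: strict_mono_Suc_iff)

lemma double_Suc_le_power:
  fixes n :: nat
  assumes "3 \<le> n"
  shows "2 * n + 1 \<le> 2 ^ n"
  using assms by (induction n rule: dec_induct) auto

lemma double_tower_add_3_le:
  assumes "1 \<le> h"
  shows "2 * tower h + 3 \<le> tower (h + 2)"
proof -
  have "tower 1 \<le> tower h" using assms strict_mono_tower by (simp only: strict_mono_less_eq)
  then have "2 ^ 2 \<le> (2::nat) ^ tower h" by (intro power_increasing) simp_all
  then have "3 \<le> (2::nat) ^ tower h" by simp
  have "tower h + 1 \<le> 2 ^ tower h" by (simp add: Suc_leI)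
  then have "2 * tower h + 3 \<le> 2 * 2 ^ tower h + 1" by simp
  also have "\<dots> \<le> 2 ^ 2 ^ tower h" using \<open>3 \<le> 2 ^ tower h\<close> by (rule double_Suc_le_power)
  finally show ?thesis by simp
qed

lemma log_star_le_tower:
  assumes "x \<le> real (tower j)"
  shows "log_star x \<le> j"
proof -
  have "\<exists>k\<le>j. ((\<lambda>y. log 2 y) ^^ k) x \<le> 1"
    using assms
  proof (induction j arbitrary: x)
    case (Suc j)
    show ?case
    proof (cases "x \<le> 1")
      case True
      then show ?thesis by (intro exI[of _ 0]) simp
    next
      case False
      have "log 2 x \<le> log 2 (2 ^ tower j)" using False Suc.prems by (subst log_le_cancel_iff) auto
      then have "log 2 x \<le> real (tower j)" by simp
      then obtain k where "k \<le> j" "((\<lambda>y. log 2 y) ^^ k) (log 2 x) \<le> 1" using Suc.IH by blast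
      then show ?thesis by (intro exI[of _ "Suc k"]) (simp add: funpow_swap1)
    qed
  qed simp
  then obtain k where "k \<le> j" "((\<lambda>y. log 2 y) ^^ k) x \<le> 1" by blast
  then show ?thesis unfolding log_star_def by (meson Least_le le_trans)
qed

lemma threshold_le: "threshold N k j \<le> 2 * N * Suc k * Suc N ^ j"
proof (induction j)
  case (Suc j)
  have "N * threshold N k j + 2 * N * Suc k
      \<le> N * (2 * N * Suc k * Suc N ^ j) + 2 * N * Suc k * Suc N ^ j"
    by (intro add_mono mult_le_mono2 Suc.IH) simp
  also have "\<dots> = 2 * N * Suc k * Suc N ^ Suc j" by (simp add: algebra_simps)
  finally show ?case by simp
qed simp

lemma accept_bound_le:
  assumes "Suc k \<le> N" "3 \<le> N"
  shows "accept_bound N k \<le> 2 ^ 2 ^ 2 ^ N"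
proof -
  have N: "N + 1 \<le> 2 ^ N" by (simp add: Suc_leI)
  have "accept_bound N k \<le> N * (2 * N * Suc k * Suc N ^ N)"
    unfolding accept_bound_def by (intro mult_le_mono2 threshold_le)
  also have "\<dots> \<le> 2 ^ N * (2 * 2 ^ N * 2 ^ N * (2 ^ N) ^ N)"
    using N assms(1) by (intro mult_le_mono power_mono) auto
  also have "\<dots> = 2 ^ (1 + 3 * N + N * N)"
    by (simp add: power_add power_mult algebra_simps power3_eq_cube)
  also have "1 + 3 * N + N * N \<le> (2 ^ (N + 1)) ^ 2"
  proof -
    have "1 + 3 * N + N * N \<le> (N + 2) ^ 2" by (simp add: power2_eq_square)
    also have "\<dots> \<le> (2 ^ (N + 1)) ^ 2" using N by (intro power_mono) auto
    finally show ?thesis .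
  qed
  also have "(2 ^ (N + 1)) ^ 2 = (2::nat) ^ (2 * N + 2)"
    by (simp add: power_mult[symmetric] algebra_simps)
  also have "2 * N + 2 \<le> 2 ^ N"
    using assms(2) by (induction N rule: dec_induct) auto
  finally show ?thesis by (simp add: power_increasing)
qed

lemma type_count_bounds:
  fixes k :: nat
  assumes "1 \<le> k"
  defines "N \<equiv> 2 * 2 ^ (2 ^ k * 2 ^ k)"
  shows "Suc k \<le> N" "3 \<le> N" "N \<le> 2 ^ 2 ^ 2 ^ 2 ^ k"
proof -
  have N: "N = 2 ^ Suc (2 ^ (2 * k))" by (simp add: N_def mult_2 power_add)
  have "k < 2 ^ k" by simp
  also have "\<dots> \<le> (2::nat) ^ (2 * k)" by (intro power_increasing) auto
  also have "\<dots> < 2 ^ 2 ^ (2 * k)" by (rule less_exp)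
  also have "\<dots> \<le> N" by (simp add: N)
  finally show "Suc k \<le> N" by simp
  have "(1::nat) \<le> 2 ^ (2 * k)" by simp
  then have "(2::nat) ^ Suc 1 \<le> N" unfolding N by (intro power_increasing) simp_all
  then show "3 \<le> N" by simp
  obtain j where j: "k = Suc j" using assms(1) by (cases k) auto
  have "Suc j \<le> 2 ^ j" by (simp add: Suc_leI)
  then have "2 * k \<le> 2 ^ k" unfolding j by simp
  then have "(2::nat) ^ (2 * k) \<le> 2 ^ 2 ^ k" by (intro power_increasing) auto
  then have "Suc (2 ^ (2 * k)) \<le> Suc (2 ^ 2 ^ k)" by simp
  also have "\<dots> \<le> 2 ^ 2 ^ 2 ^ k" by (simp add: Suc_leI)
  finally show "N \<le> 2 ^ 2 ^ 2 ^ 2 ^ k" unfolding N by (intro power_increasing) auto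
qed

lemma superweak_colorable_step:
  assumes "superweak_colorable m (Suc t) (tower h)"
  shows "superweak_colorable m t (tower (h + 7))"
proof -
  obtain col demands accepts where "superweak_coloring m (Suc t) (tower h) col demands accepts"
    using assms unfolding superweak_colorable_def by blast
  then interpret speedup m t "tower h" col demands accepts by (simp add: speedup_def)
  note bounds = type_count_bounds[OF tower_pos[of h], folded card_all_types]
  have N: "card all_types \<le> tower (h + 4)" using bounds(3) by (simp add: eval_nat_numeral)
  have "2 ^ card all_types \<le> (2::nat) ^ tower (h + 4)" using N by (intro power_increasing) auto
  also have "\<dots> = tower (h + 5)" by (simp add: eval_nat_numeral)
  also have "\<dots> \<le> tower (h + 7)" using strict_mono_tower by (simp add: strict_mono_less_eq)
  finally have colors: "2 ^ card all_types \<le> tower (h + 7)" .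
  have "accept_bound (card all_types) (tower h) \<le> 2 ^ 2 ^ 2 ^ card all_types"
    by (rule accept_bound_le[OF bounds(1,2)])
  also have "\<dots> \<le> 2 ^ 2 ^ 2 ^ tower (h + 4)" using N by (intro power_increasing) auto
  also have "\<dots> = tower (h + 7)" by (simp add: eval_nat_numeral)
  finally show ?thesis by (rule superweak_colorable_one_round_less[OF colors])
qed

lemma not_superweak_colorable:
  assumes "tower (h + 7 * t) < m"
  shows "\<not> superweak_colorable m t (tower h)"
  using assms
proof (induction t arbitrary: h)
  case 0
  then show ?case using not_superweak_colorable_0[of m "tower h"] by simp
next
  case (Suc t)
  have "tower (h + 7 + 7 * t) < m" using Suc.prems by (simp add: algebra_simps)
  then show ?case using superweak_colorable_step Suc.IH by blast
qed

context ported_trees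
begin

subsection \<open>A linear order on the nodes of a tree\<close>

text \<open>Following Goos, Hirvonen and Suomela, a path has value the number of its forward edges minus its
  backward edges, plus a sign for every inner node telling whether the leaving port exceeds the entering
  one. This is a sum of an odd number of signs, hence nonzero, and it is negated by reversal; around a
  tripod all contributions cancel except those of its center, which gives transitivity.\<close>

definition edge_sign :: "nat \<Rightarrow> int" where "edge_sign p = (if p \<le> m then 1 else -1)"

definition turn_sign :: "nat \<Rightarrow> nat \<Rightarrow> int" where "turn_sign p q = sgn (int q - int p)"

fun descent :: "ptree \<Rightarrow> nat list \<Rightarrow> int" where
  "descent y [] = 0"
| "descent y (p # a) =
    edge_sign p + (if a = [] then 0 else turn_sign (y [p]) (hd a)) + descent (branch y p) a"

declare descent.simps(2) [simp del]

definition entry_descent :: "ptree \<Rightarrow> nat list \<Rightarrow> int" where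
  "entry_descent y a = (if a = [] then 0 else turn_sign (y []) (hd a) + descent y a)"

fun path_value :: "ptree \<Rightarrow> nat list \<Rightarrow> nat list \<Rightarrow> int" where
  "path_value y [] b = descent y b"
| "path_value y (p # a) [] = - descent y (p # a)"
| "path_value y (p # a) (q # b) = (if p = q then path_value (branch y p) a b
    else - descent y (p # a) + turn_sign p q + descent y (q # b))"

definition diverging :: "nat list \<Rightarrow> nat list \<Rightarrow> bool" where
  "diverging a b \<longleftrightarrow> a = [] \<or> b = [] \<or> hd a \<noteq> hd b"

lemma turn_sign_swap: "turn_sign q p = - turn_sign p q"
  by (simp add: turn_sign_def sgn_if)

lemma turn_sign_odd: "p \<noteq> q \<Longrightarrow> odd (turn_sign p q)"
  by (auto simp: turn_sign_def sgn_if)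

lemma turn_sign_bounds: "- 1 \<le> turn_sign p q" "turn_sign p q \<le> 1"
  by (auto simp: turn_sign_def sgn_if)

lemma turn_sign_cycle: "\<bar>turn_sign p q + turn_sign q r + turn_sign r p\<bar> \<le> 1"
  by (auto simp: turn_sign_def sgn_if)

lemma edge_sign_odd: "odd (edge_sign p)"
  by (simp add: edge_sign_def)

lemma edge_sign_opposite: "opposite p q \<Longrightarrow> edge_sign q = - edge_sign p"
  by (auto simp: opposite_def edge_sign_def)

lemma descent_Cons: "descent y (p # a) = edge_sign p + entry_descent (branch y p) a"
  by (simp add: entry_descent_def descent.simps(2))

lemma path_value_Nil2 [simp]: "path_value y a [] = - descent y a"
  by (cases a) auto

lemma path_value_self [simp]: "path_value y a a = 0"
  by (induction a arbitrary: y) auto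

lemma path_value_diverging:
  "diverging a b \<Longrightarrow> path_value y a b =
     descent y b - descent y a + (if a = [] \<or> b = [] then 0 else turn_sign (hd a) (hd b))"
  by (cases a; cases b) (auto simp: diverging_def)

lemma path_value_anti: "path_value y b a = - path_value y a b"
proof (induction y a b rule: path_value.induct)
  case (3 y p a q b)
  then show ?case using turn_sign_swap[of p q] by (cases "p = q") simp_all
qed simp_all

lemma descent_odd: "reduced y a \<Longrightarrow> a \<noteq> [] \<Longrightarrow> odd (descent y a)"
proof (induction a arbitrary: y)
  case (Cons p a)
  show ?case
  proof (cases "a = []")
    case True
    then show ?thesis by (simp add: descent.simps(2) edge_sign_odd)
  next
    case False
    then have "y [p] \<noteq> hd a" "reduced (branch y p) a"
      using Cons.prems(1) by (cases a; simp add: exits_def)+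
    then show ?thesis
      using Cons.IH False by (simp add: descent.simps(2) edge_sign_odd turn_sign_odd)
  qed
qed simp

lemma path_value_odd: "reduced y a \<Longrightarrow> reduced y b \<Longrightarrow> a \<noteq> b \<Longrightarrow> odd (path_value y a b)"
proof (induction y a b rule: path_value.induct)
  case (1 y b)
  then show ?case using descent_odd[of y b] by simp
next
  case (2 y p a)
  then show ?case using descent_odd[of y "p # a"] by simp
next
  case (3 y p a q b)
  show ?case
  proof (cases "p = q")
    case True
    then show ?thesis using 3 by auto
  next
    case False
    have "odd (descent y (p # a))" "odd (descent y (q # b))" "odd (turn_sign p q)"
      using 3 False descent_odd turn_sign_odd by blast+
    then show ?thesis using False by simp
  qed
qed

lemma path_value_via_entry: "\<bar>path_value y a b + entry_descent y a - entry_descent y b\<bar> \<le> 1"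
proof (induction y a b rule: path_value.induct)
  case (1 y b)
  show ?case using turn_sign_bounds[of "y []" "hd b"] by (auto simp: entry_descent_def)
next
  case (2 y p a)
  show ?case using turn_sign_bounds[of "y []" p] by (simp add: entry_descent_def)
next
  case (3 y p a q b)
  show ?case
  proof (cases "p = q")
    case True
    then show ?thesis using 3 by (simp add: entry_descent_def[of y] descent_Cons)
  next
    case False
    then show ?thesis
      using turn_sign_cycle[of "y []" p q] turn_sign_swap[of "y []" q]
      by (simp add: entry_descent_def)
  qed
qed

lemma path_value_tripod_branch:
  assumes "diverging c (p # a)"
  shows "\<bar>path_value y (p # a) (p # b) + path_value y (p # b) c + path_value y c (p # a)\<bar> \<le> 1"
proof -
  have "diverging (p # b) c" using assms by (auto simp: diverging_def)
  then have "path_value y (p # b) c + path_value y c (p # a) =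
      descent y (p # a) - descent y (p # b)"
    using assms turn_sign_swap[of p "hd c"] by (simp add: path_value_diverging)
  then show ?thesis
    using path_value_via_entry[of "branch y p" a b] by (simp add: descent_Cons)
qed

lemma path_value_tripod: "\<bar>path_value y a b + path_value y b c + path_value y c a\<bar> \<le> 1"
proof (induction "length a" arbitrary: y a b c rule: less_induct)
  case less
  consider (common) p a' b' c' where "a = p # a'" "b = p # b'" "c = p # c'"
    | (ab) p a' b' where "a = p # a'" "b = p # b'" "diverging c a"
    | (bc) p b' c' where "b = p # b'" "c = p # c'" "diverging a b"
    | (ca) p c' a' where "c = p # c'" "a = p # a'" "diverging b c"
    | (apart) "diverging a b" "diverging b c" "diverging c a"
    by (cases a; cases b; cases c) (auto simp: diverging_def)
  then show ?case
  proof cases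
    case common
    then show ?thesis using less[of a' "branch y p" b' c'] by simp
  next
    case ab
    then show ?thesis using path_value_tripod_branch[of c p a' y b'] by simp
  next
    case bc
    then show ?thesis using path_value_tripod_branch[of a p b' y c'] by simp
  next
    case ca
    then show ?thesis using path_value_tripod_branch[of b p c' y a'] by simp
  next
    case apart
    then show ?thesis
      using turn_sign_bounds[of "hd a" "hd b"] turn_sign_bounds[of "hd b" "hd c"]
        turn_sign_bounds[of "hd c" "hd a"] turn_sign_cycle[of "hd a" "hd b" "hd c"]
      by (auto simp: path_value_diverging)
  qed
qed

lemma descent_cong: "agree t x y \<Longrightarrow> length a \<le> t \<Longrightarrow> descent x a = descent y a"
proof (induction a arbitrary: x y t)
  case (Cons p a)
  obtain s where t: "t = Suc s" using Cons.prems(2) by (cases t) auto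
  have "x [p] = y [p]" using Cons.prems by (simp add: agree_def)
  moreover have "descent (branch x p) a = descent (branch y p) a"
    using Cons.prems t by (intro Cons.IH[of s]) (simp_all add: agree_Suc)
  ultimately show ?case by (simp add: descent.simps(2))
qed simp

lemma path_value_cong:
  "agree t x y \<Longrightarrow> length a \<le> t \<Longrightarrow> length b \<le> t \<Longrightarrow> path_value x a b = path_value y a b"
proof (induction x a b arbitrary: y t rule: path_value.induct)
  case (3 x p a q b)
  obtain s where t: "t = Suc s" using 3(3) by (cases t) auto
  have "descent x c = descent y c" if "length c \<le> t" for c
    using descent_cong[OF 3(2) that] .
  then show ?case using 3 t by (auto simp: agree_Suc)
qed (simp_all add: descent_cong)

lemma reduced_cong: "agree t x y \<Longrightarrow> length a \<le> t \<Longrightarrow> reduced x a = reduced y a"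
proof (induction a arbitrary: x y t)
  case (Cons p a)
  obtain s where "t = Suc s" using Cons.prems by (cases t) auto
  then show ?case
    using Cons.IH[of s "branch x p" "branch y p"] Cons.prems by (simp add: agree_Suc exits_def)
qed simp

definition before :: "ptree \<Rightarrow> nat list \<Rightarrow> nat list \<Rightarrow> bool" where
  "before x a b \<longleftrightarrow> 0 < path_value x a b"

lemma before_irrefl: "\<not> before x a a"
  by (simp add: before_def)

lemma before_trans: "before x a b \<Longrightarrow> before x b c \<Longrightarrow> before x a c"
  using path_value_tripod[of x a b c] path_value_anti[of x c a] unfolding before_def by linarith

lemma before_total:
  assumes "reduced x a" "reduced x b" "a \<noteq> b"
  shows "before x a b \<or> before x b a"
proof -
  have "path_value x a b \<noteq> 0" using path_value_odd[OF assms] by force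
  then show ?thesis using path_value_anti[of x b a] unfolding before_def by linarith
qed

lemma before_cong:
  "agree t x y \<Longrightarrow> length a \<le> t \<Longrightarrow> length b \<le> t \<Longrightarrow> before x a b \<longleftrightarrow> before y a b"
  by (simp add: before_def path_value_cong)

subsection \<open>Addresses in a rerooted tree\<close>

definition reroot_address :: "ptree \<Rightarrow> nat \<Rightarrow> nat list \<Rightarrow> nat list" where
  "reroot_address x p a = (if a \<noteq> [] \<and> hd a = x [p] then tl a else p # a)"

lemma reroot_address_Nil [simp]: "reroot_address x p [] = [p]"
  by (simp add: reroot_address_def)

lemma reroot_address_back [simp]: "reroot_address x p (x [p] # b) = b"
  by (simp add: reroot_address_def)

lemma reroot_address_away: "diverging a [x [p]] \<Longrightarrow> reroot_address x p a = p # a"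
  by (auto simp: reroot_address_def diverging_def)

lemma length_reroot_address: "length (reroot_address x p a) \<le> Suc (length a)"
  by (auto simp: reroot_address_def)

lemma reduced_cut: "valid_tree x \<Longrightarrow> reduced (cut x p) b \<longleftrightarrow> reduced x b \<and> diverging b [p]"
  by (cases b) (auto simp: branch_cut valid_tree_Nil exits_def diverging_def)

lemma reduced_reroot_cases:
  assumes x: "valid_tree x" and a: "reduced (reroot x p) a"
  obtains (away) "diverging a [x [p]]" "reduced (branch x p) a"
    | (returning) b where "a = x [p] # b" "reduced x b" "diverging b [p]"
proof (cases "diverging a [x [p]]")
  case True
  then have "reduced (branch x p) a"
    using a by (cases a) (auto simp: branch_reroot exits_def diverging_def)
  then show ?thesis using True away by blast
next
  case False
  then obtain b where b: "a = x [p] # b" by (cases a) (auto simp: diverging_def)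
  then have "reduced (cut x p) b" using a by (simp add: branch_reroot)
  then show ?thesis using returning b reduced_cut[OF x] by blast
qed

lemma reduced_reroot_address:
  assumes "valid_tree x" "p < port_count" "reduced (reroot x p) a"
  shows "reduced x (reroot_address x p a)"
  using assms(1,3)
proof (cases rule: reduced_reroot_cases)
  case away
  then show ?thesis using assms(1,2) by (simp add: reroot_address_away exits_valid_tree)
qed simp

lemma inj_on_reroot_address:
  assumes "valid_tree x"
  shows "inj_on (reroot_address x p) {a. reduced (reroot x p) a}"
proof (rule inj_onI)
  fix a b
  assume a: "a \<in> {a. reduced (reroot x p) a}" and b: "b \<in> {a. reduced (reroot x p) a}"
    and eq: "reroot_address x p a = reroot_address x p b"
  have "reduced (reroot x p) a" "reduced (reroot x p) b" using a b by auto
  note cases_a = reduced_reroot_cases[OF assms this(1)]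
    and cases_b = reduced_reroot_cases[OF assms this(2)]
  show "a = b"
    by (cases rule: cases_a; cases rule: cases_b)
      (use eq in \<open>auto simp: reroot_address_away diverging_def\<close>)
qed

lemma descent_cut: "diverging b [p] \<Longrightarrow> descent (cut x p) b = descent x b"
  by (cases b) (auto simp: descent.simps(2) branch_cut diverging_def)

lemma path_value_cut:
  assumes "diverging a [p]" "diverging b [p]"
  shows "path_value (cut x p) a b = path_value x a b"
proof (cases "diverging a b")
  case True
  then show ?thesis using assms by (simp add: path_value_diverging descent_cut)
next
  case False
  then obtain r a' b' where "a = r # a'" "b = r # b'"
    by (cases a; cases b) (auto simp: diverging_def)
  then show ?thesis using assms by (simp add: branch_cut diverging_def)
qed

lemma descent_reroot_away:
  "diverging a [x [p]] \<Longrightarrow> descent (reroot x p) a = descent (branch x p) a"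
  by (cases a) (auto simp: descent.simps(2) branch_reroot reroot_Cons diverging_def)

lemma path_value_reroot_away:
  assumes "diverging a [x [p]]" "diverging b [x [p]]"
  shows "path_value (reroot x p) a b = path_value (branch x p) a b"
proof (cases "diverging a b")
  case True
  then show ?thesis using assms by (simp add: path_value_diverging descent_reroot_away)
next
  case False
  then obtain r a' b' where "a = r # a'" "b = r # b'"
    by (cases a; cases b) (auto simp: diverging_def)
  then show ?thesis using assms by (simp add: branch_reroot diverging_def)
qed

lemma path_value_reroot_away_back:
  assumes opp: "opposite p (x [p])" and a: "diverging a [x [p]]" and b: "diverging b [p]"
  shows "path_value (reroot x p) a (x [p] # b) = path_value x (p # a) b"
proof -
  have "diverging a (x [p] # b)" "diverging (p # a) b"
    using a b by (auto simp: diverging_def)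
  then show ?thesis
    using a b edge_sign_opposite[OF opp] turn_sign_swap[of "hd a" "x [p]"]
    by (simp add: path_value_diverging descent_reroot_away descent_Cons entry_descent_def
        branch_reroot descent_cut)
qed

lemma path_value_reroot:
  assumes x: "valid_tree x" and p: "p < port_count"
    and a: "reduced (reroot x p) a" and b: "reduced (reroot x p) b"
  shows "path_value (reroot x p) a b = path_value x (reroot_address x p a) (reroot_address x p b)"
proof -
  note mixed = path_value_reroot_away_back[of p x, OF valid_tree_opposite[OF x p]]
  from x a show ?thesis
  proof (cases rule: reduced_reroot_cases)
    case a: away
    from x b show ?thesis
    proof (cases rule: reduced_reroot_cases)
      case away
      then show ?thesis using a by (simp add: path_value_reroot_away reroot_address_away)
    next
      case (returning b')
      then show ?thesis using a by (simp add: mixed reroot_address_away)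
    qed
  next
    case a: (returning a')
    from x b show ?thesis
    proof (cases rule: reduced_reroot_cases)
      case away
      then show ?thesis
        using a path_value_anti[of "reroot x p" b a] path_value_anti[of x "p # b" a']
        by (simp add: mixed reroot_address_away)
    next
      case (returning b')
      then show ?thesis using a by (simp add: branch_reroot path_value_cut)
    qed
  qed
qed

lemma before_reroot:
  assumes "valid_tree x" "p < port_count" "reduced (reroot x p) a" "reduced (reroot x p) b"
  shows "before (reroot x p) a b \<longleftrightarrow> before x (reroot_address x p a) (reroot_address x p b)"
  using path_value_reroot[OF assms] by (simp add: before_def)

definition adj :: "ptree \<Rightarrow> nat list \<Rightarrow> nat list set" where
  "adj y a = (\<lambda>r. a @ [r]) ` ({..<port_count} - {y a}) \<union> (if a = [] then {} else {butlast a})"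

lemma adj_root: "valid_tree x \<Longrightarrow> adj x [] = (\<lambda>r. [r]) ` {..<port_count}"
  by (auto simp: adj_def valid_tree_Nil)

lemma reroot_address_adj_away:
  assumes x: "valid_tree x" and p: "p < port_count" and a: "diverging a [x [p]]"
  shows "reroot_address x p ` adj (reroot x p) a = adj x (p # a)"
proof (cases "a = []")
  case True
  have "{..<port_count} = insert (x [p]) ({..<port_count} - {x [p]})"
    using valid_tree_entry_less[OF x p] by auto
  then have "reroot_address x p ` adj (reroot x p) [] =
      (\<lambda>r. reroot_address x p [r]) ` insert (x [p]) ({..<port_count} - {x [p]})"
    using adj_root[OF valid_tree_reroot[OF x p]] by (simp add: image_image)
  also have "\<dots> = insert [] ((\<lambda>r. [p, r]) ` ({..<port_count} - {x [p]}))"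
    by (auto simp: reroot_address_def)
  finally show ?thesis using True by (simp add: adj_def)
next
  case False
  then have "reroot x p a = x (p # a)"
    using a by (cases a) (auto simp: reroot_Cons diverging_def)
  moreover have "diverging (a @ [r]) [x [p]]" "diverging (butlast a) [x [p]]" for r
    using a False by (cases a; auto simp: diverging_def)+
  ultimately show ?thesis
    using False by (simp add: adj_def image_Un image_image reroot_address_away)
qed

lemma reroot_address_adj_returning:
  assumes x: "valid_tree x" and p: "p < port_count" and b: "diverging b [p]"
  shows "reroot_address x p ` adj (reroot x p) (x [p] # b) = adj x b"
proof (cases "b = []")
  case True
  have "reroot_address x p ` adj (reroot x p) [x [p]] =
      insert [p] ((\<lambda>r. [r]) ` ({..<port_count} - {p}))"
    by (simp add: adj_def image_image)
  also have "\<dots> = (\<lambda>r. [r]) ` {..<port_count}" using p by auto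
  finally show ?thesis using True adj_root[OF x] by simp
next
  case False
  then have "reroot x p (x [p] # b) = x b"
    using b by (cases b) (auto simp: reroot_Cons diverging_def)
  then show ?thesis using False by (simp add: adj_def image_image)
qed

lemma reroot_address_adj:
  assumes x: "valid_tree x" and p: "p < port_count" and a: "reduced (reroot x p) a"
  shows "reroot_address x p ` adj (reroot x p) a = adj x (reroot_address x p a)"
  using x a
proof (cases rule: reduced_reroot_cases)
  case away
  then show ?thesis using reroot_address_adj_away[OF x p] by (simp add: reroot_address_away)
next
  case (returning b)
  then show ?thesis using reroot_address_adj_returning[OF x p] by simp
qed

lemma reduced_snoc: "reduced y (a @ [r]) \<longleftrightarrow> reduced y a \<and> r < port_count \<and> r \<noteq> y a"
  by (induction a arbitrary: y) (auto simp: exits_def branch_apply)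

lemma reduced_butlast: "reduced x a \<Longrightarrow> reduced x (butlast a)"
  by (cases a rule: rev_cases) (auto simp: reduced_snoc)

lemma mem_adj_butlast:
  assumes "reduced x a" "a \<noteq> []"
  shows "a \<in> adj x (butlast a)"
proof -
  obtain b r where a: "a = b @ [r]" using assms(2) by (metis rev_exhaust)
  then show ?thesis using assms(1) by (simp add: adj_def reduced_snoc)
qed

lemma card_adj:
  assumes x: "valid_tree x" and a: "reduced x a"
  shows "card (adj x a) = port_count"
proof (cases "a = []")
  case True
  then show ?thesis using adj_root[OF x] by (simp add: card_image inj_on_def)
next
  case False
  have "card ((\<lambda>r. a @ [r]) ` ({..<port_count} - {x a})) = port_count - 1"
    using entry_less[OF x a False] by (simp add: card_image inj_on_def)
  moreover have "length b = Suc (length a)" if "b \<in> (\<lambda>r. a @ [r]) ` ({..<port_count} - {x a})" for b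
    using that by auto
  then have "butlast a \<notin> (\<lambda>r. a @ [r]) ` ({..<port_count} - {x a})"
    by (metis Suc_n_not_le_n diff_le_self length_butlast)
  ultimately show ?thesis using False by (simp add: adj_def) (simp add: port_count_def)
qed

subsection \<open>Balls in a tree\<close>

definition ball :: "ptree \<Rightarrow> nat \<Rightarrow> nat list set" where
  "ball y t = {a. reduced y a \<and> length a \<le> t}"

primrec branch_size :: "nat \<Rightarrow> nat" where
  "branch_size 0 = 1"
| "branch_size (Suc t) = Suc ((port_count - 1) * branch_size t)"

definition ball_size :: "nat \<Rightarrow> nat" where
  "ball_size t = (case t of 0 \<Rightarrow> 1 | Suc s \<Rightarrow> Suc (port_count * branch_size s))"

lemma ball_0: "ball y 0 = {[]}"
  by (auto simp: ball_def)

lemma Nil_in_ball [simp]: "[] \<in> ball y t"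
  by (simp add: ball_def)

lemma ball_mono: "s \<le> t \<Longrightarrow> ball y s \<subseteq> ball y t"
  by (auto simp: ball_def)

lemma ball_SucI: "a \<in> ball y t \<Longrightarrow> a \<in> ball y (Suc t)"
  by (simp add: ball_def)

lemma ball_Suc: "ball y (Suc t) = insert [] (\<Union>p\<in>exits y. (#) p ` ball (branch y p) t)"
proof (intro set_eqI)
  fix a
  show "a \<in> ball y (Suc t) \<longleftrightarrow> a \<in> insert [] (\<Union>p\<in>exits y. (#) p ` ball (branch y p) t)"
    by (cases a) (auto simp: ball_def)
qed

lemma finite_ball: "finite (ball y t)"
  by (induction t arbitrary: y) (simp_all add: ball_0 ball_Suc)

lemma card_ball_Suc:
  assumes "\<And>p. p \<in> exits y \<Longrightarrow> card (ball (branch y p) t) = n"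
  shows "card (ball y (Suc t)) = Suc (card (exits y) * n)"
proof -
  have "card (\<Union>p\<in>exits y. (#) p ` ball (branch y p) t) =
      (\<Sum>p\<in>exits y. card ((#) p ` ball (branch y p) t))"
    by (rule card_UN_disjoint) (auto simp: finite_ball)
  also have "\<dots> = (\<Sum>p\<in>exits y. n)"
    using assms by (intro sum.cong) (auto simp: card_image)
  also have "\<dots> = card (exits y) * n" by simp
  finally show ?thesis unfolding ball_Suc by (subst card_insert_disjoint) (auto simp: finite_ball)
qed

lemma card_ball_branch:
  "valid_branch y \<Longrightarrow> y [] < port_count \<Longrightarrow> card (ball y t) = branch_size t"
proof (induction t arbitrary: y)
  case (Suc t)
  have "card (ball (branch y p) t) = branch_size t" if "p \<in> exits y" for p
    using valid_branch_exitD[OF Suc.prems(1) that] opposite_less(2) by (intro Suc.IH) auto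
  then show ?case using card_ball_Suc[of y t] Suc.prems(2) by (simp add: exits_def)
qed (simp add: ball_0)

lemma card_ball:
  assumes x: "valid_tree x"
  shows "card (ball x t) = ball_size t"
proof (cases t)
  case (Suc s)
  have "card (ball (branch x p) s) = branch_size s" if "p \<in> exits x" for p
    using x that valid_tree_entry_less valid_tree_branch
    by (intro card_ball_branch) (simp_all add: exits_valid_tree)
  then show ?thesis using card_ball_Suc[of x s] Suc x by (simp add: ball_size_def exits_valid_tree)
qed (simp add: ball_0 ball_size_def)

lemma ball_cong: "agree t x y \<Longrightarrow> ball x t = ball y t"
  unfolding ball_def using reduced_cong[of t x y] by (intro Collect_cong) blast

lemma butlast_in_ball: "a \<in> ball x t \<Longrightarrow> butlast a \<in> ball x (t - 1)"
  using reduced_butlast by (auto simp: ball_def)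

lemma adj_subset_ball: "a \<in> ball x t \<Longrightarrow> adj x a \<subseteq> ball x (Suc t)"
  using reduced_butlast by (auto simp: ball_def adj_def reduced_snoc exits_def)

lemma reroot_address_in_ball:
  assumes "valid_tree x" "p < port_count" "a \<in> ball (reroot x p) t"
  shows "reroot_address x p a \<in> ball x (Suc t)"
  using reduced_reroot_address[OF assms(1,2), of a] length_reroot_address[of x p a] assms(3)
  by (simp add: ball_def)

lemma ball_Suc_eq_adj: "ball x (Suc t) = ball x t \<union> (\<Union>a\<in>ball x t. adj x a)"
proof
  show "ball x t \<union> (\<Union>a\<in>ball x t. adj x a) \<subseteq> ball x (Suc t)"
    using adj_subset_ball[of _ x t] ball_SucI[of _ x t] by auto
  show "ball x (Suc t) \<subseteq> ball x t \<union> (\<Union>a\<in>ball x t. adj x a)"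
  proof
    fix a assume a: "a \<in> ball x (Suc t)"
    show "a \<in> ball x t \<union> (\<Union>a\<in>ball x t. adj x a)"
    proof (cases "a = []")
      case False
      then have "a \<in> adj x (butlast a)" using mem_adj_butlast a by (simp add: ball_def)
      moreover have "butlast a \<in> ball x t" using butlast_in_ball[OF a] by simp
      ultimately show ?thesis by blast
    qed simp
  qed
qed

end

subsection \<open>Graphs with odd degrees\<close>

definition edge_rel :: "graph \<Rightarrow> (nat \<times> nat) set" where
  "edge_rel G = {(a, b). {a, b} \<in> snd G}"

lemma sym_edge_rel: "sym (edge_rel G)"
  by (auto simp: sym_def edge_rel_def insert_commute)

lemma reach_le_if_rtrancl: "(v, u) \<in> (edge_rel G)\<^sup>* \<Longrightarrow> v \<in> fst G \<Longrightarrow> \<exists>k. reach_le G v u k"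
proof (induction rule: rtrancl_induct)
  case base
  then show ?case by (intro exI[of _ 0]) simp
next
  case (step w u)
  then obtain k where "reach_le G v w k" by blast
  moreover have "{w, u} \<in> snd G" using step.hyps(2) by (simp add: edge_rel_def)
  ultimately have "reach_le G v u (Suc k)" by auto
  then show ?case by blast
qed

lemma rtrancl_if_reach_le: "reach_le G v u k \<Longrightarrow> (v, u) \<in> (edge_rel G)\<^sup>*"
proof (induction k arbitrary: u)
  case (Suc k)
  then show ?case by (auto simp: edge_rel_def intro: rtrancl_into_rtrancl)
qed simp

lemma connected_graphI:
  assumes "r \<in> fst G" "\<And>u. u \<in> fst G \<Longrightarrow> (r, u) \<in> (edge_rel G)\<^sup>*"
  shows "connected_graph G"
  unfolding connected_graph_def
proof (intro ballI)
  fix u w assume "u \<in> fst G" "w \<in> fst G"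
  then have "(u, w) \<in> (edge_rel G)\<^sup>*"
    using assms sym_rtrancl[OF sym_edge_rel] by (meson rtrancl_trans symD)
  then show "\<exists>k. reach_le G u w k" using reach_le_if_rtrancl \<open>u \<in> fst G\<close> by blast
qed

lemma connected_graphD:
  "connected_graph G \<Longrightarrow> u \<in> fst G \<Longrightarrow> w \<in> fst G \<Longrightarrow> (u, w) \<in> (edge_rel G)\<^sup>*"
  unfolding connected_graph_def using rtrancl_if_reach_le by blast

lemma nbrs_in: "simple_graph G \<Longrightarrow> u \<in> nbrs G v \<Longrightarrow> u \<in> fst G \<and> v \<in> fst G"
  by (auto simp: simple_graph_def nbrs_def)

definition odd_graph :: "nat \<Rightarrow> graph \<Rightarrow> bool" where
  "odd_graph d G \<longleftrightarrow>
     simple_graph G \<and> connected_graph G \<and> (\<forall>v\<in>fst G. odd (deg G v) \<and> deg G v \<le> d)"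

definition attach_leaves :: "nat \<Rightarrow> nat set \<Rightarrow> graph \<Rightarrow> graph" where
  "attach_leaves l X G = (fst G \<union> X, snd G \<union> (\<lambda>x. {l, x}) ` X)"

lemma fst_attach_leaves [simp]: "fst (attach_leaves l X G) = fst G \<union> X"
  by (simp add: attach_leaves_def)

lemma nbrs_attach_leaves_other: "v \<notin> insert l X \<Longrightarrow> nbrs (attach_leaves l X G) v = nbrs G v"
  by (auto simp: nbrs_def attach_leaves_def doubleton_eq_iff)

lemma nbrs_attach_leaves_leaf:
  assumes "simple_graph G" "l \<in> fst G" "X \<inter> fst G = {}" "x \<in> X"
  shows "nbrs (attach_leaves l X G) x = {l}"
proof -
  have "{u, x} \<notin> snd G" for u
    using nbrs_in[OF assms(1), of u x] assms(3,4) by (auto simp: nbrs_def)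
  then show ?thesis
    using assms(2-4) by (auto simp: nbrs_def attach_leaves_def doubleton_eq_iff)
qed

lemma nbrs_attach_leaves_base: "l \<notin> X \<Longrightarrow> nbrs (attach_leaves l X G) l = nbrs G l \<union> X"
  by (auto simp: nbrs_def attach_leaves_def doubleton_eq_iff)

lemma simple_graph_attach_leaves:
  assumes "simple_graph G" "l \<in> fst G" "X \<inter> fst G = {}" "finite X"
  shows "simple_graph (attach_leaves l X G)"
proof -
  have "l \<noteq> x" if "x \<in> X" for x using assms(2,3) that by blast
  then show ?thesis using assms by (auto simp: simple_graph_def attach_leaves_def)
qed

lemma connected_graph_attach_leaves:
  assumes "connected_graph G" "l \<in> fst G"
  shows "connected_graph (attach_leaves l X G)"
proof (rule connected_graphI[of l])
  show "l \<in> fst (attach_leaves l X G)" using assms(2) by simp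
  fix u assume "u \<in> fst (attach_leaves l X G)"
  then consider (old) "u \<in> fst G" | (leaf) "u \<in> X" by auto
  then show "(l, u) \<in> (edge_rel (attach_leaves l X G))\<^sup>*"
  proof cases
    case old
    have "edge_rel G \<subseteq> edge_rel (attach_leaves l X G)"
      by (auto simp: edge_rel_def attach_leaves_def)
    then show ?thesis using connected_graphD[OF assms old] rtrancl_mono by blast
  qed (auto simp: edge_rel_def attach_leaves_def)
qed

lemma odd_graph_attach_two_leaves:
  assumes G: "odd_graph d G" and l: "l \<in> fst G" "deg G l = 1" and d: "3 \<le> d"
    and X: "X \<inter> fst G = {}" "card X = 2"
  shows "odd_graph d (attach_leaves l X G)"
proof -
  have simple: "simple_graph G" and "connected_graph G" using G by (auto simp: odd_graph_def)
  have finX: "finite X" using X(2) by (metis card.infinite zero_neq_numeral)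
  have finN: "finite (nbrs G l)" using l(2) by (metis card.infinite deg_def zero_neq_one)
  have "odd (deg (attach_leaves l X G) v) \<and> deg (attach_leaves l X G) v \<le> d"
    if v: "v \<in> fst (attach_leaves l X G)" for v
  proof -
    consider (leaf) "v \<in> X" | (base) "v = l" | (other) "v \<in> fst G" "v \<notin> insert l X"
      using v by auto
    then show ?thesis
    proof cases
      case leaf
      then show ?thesis using d simple l(1) X(1) by (simp add: deg_def nbrs_attach_leaves_leaf)
    next
      case base
      have "nbrs G l \<inter> X = {}" using nbrs_in[OF simple] X(1) by blast
      then have "deg (attach_leaves l X G) l = deg G l + card X"
        using l(1) X(1) finX finN
        by (subst deg_def, subst nbrs_attach_leaves_base) (auto simp: deg_def card_Un_disjoint)
      then show ?thesis using base l(2) X(2) d by simp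
    next
      case other
      then show ?thesis using G by (simp add: odd_graph_def deg_def nbrs_attach_leaves_other)
    qed
  qed
  then show ?thesis
    using simple_graph_attach_leaves[OF simple l(1) X(1) finX]
      connected_graph_attach_leaves[OF \<open>connected_graph G\<close> l(1)]
    by (auto simp: odd_graph_def)
qed

lemma ex_padded_odd_graph:
  assumes "odd_graph d G" "l \<in> fst G" "deg G l = 1" "3 \<le> d"
    and "finite X" "card X = 2 * j" "X \<inter> fst G = {}"
  shows "\<exists>G'. fst G' = fst G \<union> X \<and> odd_graph d G' \<and> (\<forall>v\<in>fst G - {l}. nbrs G' v = nbrs G v)"
  using assms
proof (induction j arbitrary: G l X)
  case 0
  then show ?case by (intro exI[of _ G]) simp
next
  case (Suc j)
  obtain Y where Y: "Y \<subseteq> X" "card Y = 2"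
    using obtain_subset_with_card_n[of 2 X] Suc.prems(6) by auto
  then obtain x where x: "x \<in> Y" by fastforce
  let ?G = "attach_leaves l Y G"
  have disj: "Y \<inter> fst G = {}" using Y(1) Suc.prems(7) by blast
  have "odd_graph d ?G" using odd_graph_attach_two_leaves[OF Suc.prems(1-4) disj Y(2)] .
  moreover have "simple_graph G" using Suc.prems(1) by (simp add: odd_graph_def)
  then have "deg ?G x = 1"
    using nbrs_attach_leaves_leaf[OF _ Suc.prems(2) disj x] by (simp add: deg_def)
  moreover have "card (X - Y) = 2 * j"
    using Suc.prems(5,6) Y by (simp add: card_Diff_subset finite_subset)
  moreover have "(X - Y) \<inter> fst ?G = {}" "x \<in> fst ?G" "finite (X - Y)"
    using Suc.prems(5,7) x by auto
  ultimately have "\<exists>G'. fst G' = fst ?G \<union> (X - Y) \<and> odd_graph d G' \<and>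
      (\<forall>v\<in>fst ?G - {x}. nbrs G' v = nbrs ?G v)"
    using Suc.prems(4) by (intro Suc.IH)
  then obtain G' where G': "fst G' = fst ?G \<union> (X - Y)" "odd_graph d G'"
      "\<forall>v\<in>fst ?G - {x}. nbrs G' v = nbrs ?G v" by blast
  have "nbrs G' v = nbrs G v" if v: "v \<in> fst G - {l}" for v
  proof -
    have "v \<notin> insert l Y" using v disj by blast
    then have "nbrs ?G v = nbrs G v" by (rule nbrs_attach_leaves_other)
    moreover have "v \<noteq> x" using x \<open>v \<notin> insert l Y\<close> by blast
    ultimately show ?thesis using G'(3) v by simp
  qed
  then show ?case using G'(1,2) Y(1) by (intro exI[of _ G']) auto
qed

subsection \<open>Order-preserving placements\<close>

definition order_iso :: "'a set \<Rightarrow> ('a \<Rightarrow> 'a \<Rightarrow> bool) \<Rightarrow> 'b::linorder set \<Rightarrow> ('a \<Rightarrow> 'b) \<Rightarrow> bool" where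
  "order_iso B r S f \<longleftrightarrow> bij_betw f B S \<and> (\<forall>a\<in>B. \<forall>b\<in>B. r a b \<longleftrightarrow> f a < f b)"

definition rank :: "'a set \<Rightarrow> ('a \<Rightarrow> 'a \<Rightarrow> bool) \<Rightarrow> 'a \<Rightarrow> nat" where
  "rank B r a = card {b \<in> B. r b a}"

definition placement :: "'a set \<Rightarrow> ('a \<Rightarrow> 'a \<Rightarrow> bool) \<Rightarrow> 'b::wellorder set \<Rightarrow> 'a \<Rightarrow> 'b" where
  "placement B r S a = enumerate S (rank B r a)"

lemma order_iso_rank:
  assumes B: "finite B"
    and trans: "\<And>a b c. r a b \<Longrightarrow> r b c \<Longrightarrow> r a c" and irrefl: "\<And>a. \<not> r a a"
    and total: "\<And>a b. a \<in> B \<Longrightarrow> b \<in> B \<Longrightarrow> a \<noteq> b \<Longrightarrow> r a b \<or> r b a"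
  shows "order_iso B r {..<card B} (rank B r)"
proof -
  have less: "rank B r a < rank B r b" if "a \<in> B" "r a b" for a b
    unfolding rank_def
  proof (rule psubset_card_mono)
    show "finite {c \<in> B. r c b}" using B by simp
    show "{c \<in> B. r c a} \<subset> {c \<in> B. r c b}" using trans irrefl that by blast
  qed
  have iff: "r a b \<longleftrightarrow> rank B r a < rank B r b" if "a \<in> B" "b \<in> B" for a b
    using less[of a b] less[of b a] total[of a b] that by force
  have inj: "inj_on (rank B r) B"
    using total less by (auto intro!: inj_onI) (metis less_irrefl)
  have "rank B r a < card B" if "a \<in> B" for a
    unfolding rank_def using that B irrefl by (intro psubset_card_mono) auto
  then have "rank B r ` B = {..<card B}"
    using card_image[OF inj] by (intro card_subset_eq) auto
  then show ?thesis using inj iff by (auto simp: order_iso_def bij_betw_def)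
qed

lemma order_iso_placement:
  assumes rank: "order_iso B r {..<card B} (rank B r)" and S: "finite S" "card S = card B"
  shows "order_iso B r S (placement B r S)"
proof -
  have bij: "bij_betw (rank B r) B {..<card S}" using rank S(2) by (simp add: order_iso_def)
  then have "bij_betw (enumerate S \<circ> rank B r) B S"
    using finite_bij_enumerate[OF S(1)] by (rule bij_betw_trans)
  moreover have "r a b \<longleftrightarrow> placement B r S a < placement B r S b" if "a \<in> B" "b \<in> B" for a b
  proof -
    have "rank B r a < card S" "rank B r b < card S" using bij_betwE[OF bij] that by auto
    then show ?thesis using rank that S(1) by (simp add: placement_def order_iso_def)
  qed
  ultimately show ?thesis by (simp add: order_iso_def placement_def[abs_def] comp_def)
qed

lemma enumerate_card_less:
  fixes S :: "'b::wellorder set"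
  assumes S: "finite S" and s: "s \<in> S"
  shows "enumerate S (card {x \<in> S. x < s}) = s"
proof -
  obtain n where n: "n < card S" "enumerate S n = s" using finite_enumerate_Ex[OF S s] by blast
  have bij: "bij_betw (enumerate S) {..<card S} S" using finite_bij_enumerate[OF S] .
  have "{x \<in> S. x < s} = enumerate S ` {..<n}"
  proof (intro set_eqI iffI)
    fix x assume "x \<in> {x \<in> S. x < s}"
    then obtain k where "k < card S" "enumerate S k = x" "x < s"
      using finite_enumerate_Ex[OF S] by blast
    then show "x \<in> enumerate S ` {..<n}" using n S by auto
  next
    fix x assume "x \<in> enumerate S ` {..<n}"
    then show "x \<in> {x \<in> S. x < s}"
      using n S by (auto simp: finite_enumerate_in_set finite_enumerate_mono)
  qed
  moreover have "inj_on (enumerate S) {..<n}"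
    using bij n(1) by (auto simp: bij_betw_def intro: inj_on_subset)
  ultimately show ?thesis using n(2) by (simp add: card_image)
qed

lemma order_iso_eq_placement:
  assumes f: "order_iso B r S f" and S: "finite S" and a: "a \<in> B"
  shows "f a = placement B r S a"
proof -
  have im: "f ` B = S" and inj: "inj_on f B" using f by (auto simp: order_iso_def bij_betw_def)
  have "{x \<in> S. x < f a} = f ` {b \<in> B. r b a}"
    using f a unfolding im[symmetric] order_iso_def by auto
  then have "card {x \<in> S. x < f a} = rank B r a"
    using inj by (simp add: rank_def card_image inj_on_subset)
  moreover have "f a \<in> S" using im a by blast
  ultimately show ?thesis
    using enumerate_card_less[OF S] by (fastforce simp: placement_def)
qed

lemma ramsey_finite_range:
  fixes r s :: nat
  assumes "finite C"
  obtains N :: nat where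
    "\<And>f. range f \<subseteq> C \<Longrightarrow> \<exists>H\<in>nsets {..<N} s. \<exists>c. \<forall>X\<in>nsets H r. f X = c"
proof -
  obtain h where h: "bij_betw h C {0..<card C}" using ex_bij_betw_finite_nat[OF assms] by blast
  obtain N :: nat where N: "partn_lst {..<N} (replicate (card C) s) r"
    using ramsey_full by blast
  have "\<exists>H\<in>nsets {..<N} s. \<exists>c. \<forall>X\<in>nsets H r. f X = c" if f: "range f \<subseteq> C" for f
  proof -
    have "h \<circ> f \<in> nsets {..<N} r \<rightarrow> {..<length (replicate (card C) s)}"
      using bij_betwE[OF h] f by fastforce
    then obtain i where "i < card C" "monochromatic {..<N} s r (h \<circ> f) i"
      using N unfolding partn_lst_def by fastforce
    then obtain H where H: "H \<in> nsets {..<N} s" "(h \<circ> f) ` nsets H r \<subseteq> {i}"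
      unfolding monochromatic_def by blast
    have "f X = the_inv_into C h i" if "X \<in> nsets H r" for X
    proof -
      have "h (f X) = i" using H(2) that by auto
      moreover have "f X \<in> C" using f by blast
      ultimately show ?thesis using the_inv_into_f_f[OF bij_betw_imp_inj_on[OF h]] by metis
    qed
    then show ?thesis using H(1) by blast
  qed
  then show thesis by (rule that)
qed

context ported_trees
begin

subsection \<open>Simulation of LOCAL algorithms\<close>

lemma order_iso_before_placement:
  assumes "valid_tree x" "finite S" "card S = ball_size t"
  shows "order_iso (ball x t) (before x) S (placement (ball x t) (before x) S)"
proof (rule order_iso_placement)
  show "order_iso (ball x t) (before x) {..<card (ball x t)} (rank (ball x t) (before x))"
    using finite_ball before_irrefl before_total
    by (intro order_iso_rank) (auto simp: ball_def intro: before_trans)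
qed (use assms in \<open>simp_all add: card_ball\<close>)

definition canonical_view :: "ptree \<Rightarrow> nat \<Rightarrow> (nat list \<Rightarrow> nat) \<Rightarrow> view" where
  "canonical_view x t e = (e ` ball x t, (\<lambda>a. {e a, e (butlast a)}) ` (ball x t - {[]}),
     (\<lambda>u. if u \<in> e ` ball x t then port_count else 0))"

lemma canonical_view_cong:
  assumes "\<And>a. a \<in> ball x t \<Longrightarrow> e a = e' a"
  shows "canonical_view x t e = canonical_view x t e'"
proof -
  have "e ` ball x t = e' ` ball x t" using assms by (intro image_cong) auto
  moreover have "(\<lambda>a. {e a, e (butlast a)}) ` (ball x t - {[]}) =
      (\<lambda>a. {e' a, e' (butlast a)}) ` (ball x t - {[]})"
  proof (rule image_cong)
    fix a assume a: "a \<in> ball x t - {[]}"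
    then have "butlast a \<in> ball x t"
      using butlast_in_ball[of a x t] ball_mono[of "t - 1" t x] by auto
    then show "{e a, e (butlast a)} = {e' a, e' (butlast a)}" using assms a by auto
  qed simp
  ultimately show ?thesis by (simp add: canonical_view_def)
qed

definition embeds :: "graph \<Rightarrow> ptree \<Rightarrow> nat \<Rightarrow> (nat list \<Rightarrow> nat) \<Rightarrow> bool" where
  "embeds G x t e \<longleftrightarrow> e [] \<in> fst G \<and> inj_on e (ball x (Suc t)) \<and>
     (\<forall>a\<in>ball x t. nbrs G (e a) = e ` adj x a) \<and>
     (\<forall>a\<in>ball x t. \<forall>b\<in>ball x t. before x a b \<longleftrightarrow> e a < e b)"

lemma embeds_root: "embeds G x t e \<Longrightarrow> e [] \<in> fst G"
  by (simp add: embeds_def)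

lemma embeds_inj_on: "embeds G x t e \<Longrightarrow> inj_on e (ball x (Suc t))"
  by (simp add: embeds_def)

lemma embeds_nbrs: "embeds G x t e \<Longrightarrow> a \<in> ball x t \<Longrightarrow> nbrs G (e a) = e ` adj x a"
  by (simp add: embeds_def)

lemma embeds_inj_on_ball: "embeds G x t e \<Longrightarrow> inj_on e (ball x t)"
  using inj_on_subset[OF embeds_inj_on ball_mono[of t "Suc t" x]] by simp

lemma embeds_order_iso: "embeds G x t e \<Longrightarrow> order_iso (ball x t) (before x) (e ` ball x t) e"
  using embeds_inj_on_ball[of G x t e]
  by (simp add: order_iso_def bij_betw_def) (simp add: embeds_def)

lemma embeds_mono:
  assumes "embeds G x (Suc t) e"
  shows "embeds G x t e"
  using assms embeds_inj_on_ball[OF assms] by (simp add: embeds_def ball_SucI)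

lemma embeds_reroot:
  assumes G: "simple_graph G" and x: "valid_tree x" and p: "p < port_count"
    and e: "embeds G x (Suc t) e"
  shows "embeds G (reroot x p) t (\<lambda>a. e (reroot_address x p a))"
  unfolding embeds_def
proof (intro conjI ballI)
  let ?y = "reroot x p" and ?i = "reroot_address x p"
  note address_ball = reroot_address_in_ball[OF x p]
  have "e [p] \<in> nbrs G (e [])" using embeds_nbrs[OF e, of "[]"] adj_root[OF x] p by simp
  then show "e (?i []) \<in> fst G" using nbrs_in[OF G] by simp
  have "inj_on ?i (ball ?y (Suc t))"
    using inj_on_reroot_address[OF x, of p] by (rule inj_on_subset) (auto simp: ball_def)
  moreover have "inj_on e (?i ` ball ?y (Suc t))"
    using embeds_inj_on[OF e] by (rule inj_on_subset) (use address_ball in blast)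
  ultimately show "inj_on (\<lambda>a. e (?i a)) (ball ?y (Suc t))"
    by (simp add: comp_inj_on[unfolded comp_def])
  show "nbrs G (e (?i a)) = (\<lambda>a. e (?i a)) ` adj ?y a" if "a \<in> ball ?y t" for a
    using embeds_nbrs[OF e address_ball[OF that]] reroot_address_adj[OF x p, of a] that
    by (simp add: ball_def flip: image_image)
  show "before ?y a b \<longleftrightarrow> e (?i a) < e (?i b)" if "a \<in> ball ?y t" "b \<in> ball ?y t" for a b
  proof -
    have "before ?y a b \<longleftrightarrow> before x (?i a) (?i b)"
      using before_reroot[OF x p] that by (simp add: ball_def)
    then show ?thesis
      using e address_ball[OF that(1)] address_ball[OF that(2)] by (simp add: embeds_def)
  qed
qed

lemma reach_le_iff_ball:
  assumes e: "embeds G x t e"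
  shows "k \<le> t \<Longrightarrow> reach_le G (e []) u k \<longleftrightarrow> u \<in> e ` ball x k"
proof (induction k arbitrary: u)
  case 0
  then show ?case using embeds_root[OF e] by (auto simp: ball_0)
next
  case (Suc k)
  have nbrs: "nbrs G (e a) = e ` adj x a" if "a \<in> ball x k" for a
    using that embeds_nbrs[OF e] ball_mono[of k t x] Suc.prems by auto
  have "reach_le G (e []) u (Suc k) \<longleftrightarrow> u \<in> e ` ball x k \<or> (\<exists>w\<in>e ` ball x k. u \<in> nbrs G w)"
    using Suc by (auto simp: nbrs_def insert_commute)
  also have "\<dots> \<longleftrightarrow> u \<in> e ` ball x k \<or> (\<exists>a\<in>ball x k. u \<in> e ` adj x a)"
    using nbrs by simp
  also have "\<dots> \<longleftrightarrow> u \<in> e ` (ball x k \<union> (\<Union>a\<in>ball x k. adj x a))" by blast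
  finally show ?case unfolding ball_Suc_eq_adj .
qed

lemma embeds_edge:
  assumes e: "embeds G x (Suc t) e" and a: "a \<in> ball x (Suc t)" "a \<noteq> []"
  shows "{e a, e (butlast a)} \<in> snd G"
proof -
  have "butlast a \<in> ball x (Suc t)"
    using butlast_in_ball[OF a(1)] ball_SucI by simp
  moreover have "a \<in> adj x (butlast a)" using mem_adj_butlast a by (simp add: ball_def)
  ultimately have "e a \<in> nbrs G (e (butlast a))" using embeds_nbrs[OF e] by auto
  then show ?thesis by (simp add: nbrs_def)
qed

lemma embeds_edgeE:
  assumes e: "embeds G x (Suc t) e" and a: "a \<in> ball x t" and w: "{e a, w} \<in> snd G"
  obtains b where "b \<in> ball x (Suc t)" "b \<noteq> []" "{e a, w} = {e b, e (butlast b)}"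
proof -
  have a_Suc: "a \<in> ball x (Suc t)" using a by (rule ball_SucI)
  have "w \<in> nbrs G (e a)" using w by (simp add: nbrs_def insert_commute)
  then obtain b where b: "b \<in> adj x a" "w = e b" using embeds_nbrs[OF e a_Suc] by auto
  then consider (child) s where "b = a @ [s]" | (parent) "a \<noteq> []" "b = butlast a"
    by (auto simp: adj_def split: if_splits)
  then show ?thesis
  proof cases
    case child
    moreover have "b \<in> ball x (Suc t)" using adj_subset_ball[OF a] b(1) by blast
    ultimately show ?thesis using that[of b] b(2) by (simp add: insert_commute)
  next
    case parent
    then show ?thesis using that[of a] a_Suc b(2) by simp
  qed
qed

lemma local_view_edges:
  assumes G: "simple_graph G" and e: "embeds G x t e"
  shows "{f \<in> snd G. \<exists>u\<in>f. t > 0 \<and> reach_le G (e []) u (t - 1)} =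
    (\<lambda>a. {e a, e (butlast a)}) ` (ball x t - {[]})"
proof (cases t)
  case 0
  then show ?thesis by (simp add: ball_0)
next
  case (Suc s)
  note e = e[unfolded Suc]
  have reach: "reach_le G (e []) u s \<longleftrightarrow> u \<in> e ` ball x s" for u
    using reach_le_iff_ball[OF e] by simp
  show ?thesis
  proof (intro subset_antisym subsetI)
    fix f assume "f \<in> {f \<in> snd G. \<exists>u\<in>f. t > 0 \<and> reach_le G (e []) u (t - 1)}"
    then obtain a where a: "a \<in> ball x s" "e a \<in> f" and f: "f \<in> snd G" using reach Suc by auto
    have "card f = 2" using G f by (auto simp: simple_graph_def)
    then obtain w where "f = {e a, w}" using a(2) by (auto simp: card_2_iff)
    then show "f \<in> (\<lambda>a. {e a, e (butlast a)}) ` (ball x t - {[]})"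
      using embeds_edgeE[OF e a(1)] f Suc by blast
  next
    fix f assume "f \<in> (\<lambda>a. {e a, e (butlast a)}) ` (ball x t - {[]})"
    then obtain a where a: "a \<in> ball x (Suc s)" "a \<noteq> []" "f = {e a, e (butlast a)}"
      using Suc by blast
    have "butlast a \<in> ball x s" using butlast_in_ball[OF a(1)] by simp
    then show "f \<in> {f \<in> snd G. \<exists>u\<in>f. t > 0 \<and> reach_le G (e []) u (t - 1)}"
      using embeds_edge[OF e a(1,2)] a(3) reach Suc by auto
  qed
qed

lemma deg_embeds:
  assumes x: "valid_tree x" and e: "embeds G x t e" and a: "a \<in> ball x t"
  shows "deg G (e a) = port_count"
proof -
  have "inj_on e (adj x a)" using embeds_inj_on[OF e] adj_subset_ball[OF a] by (rule inj_on_subset)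
  then show ?thesis
    using card_adj[OF x, of a] a embeds_nbrs[OF e a] by (simp add: deg_def ball_def card_image)
qed

lemma local_view_eq_canonical_view:
  assumes x: "valid_tree x" and G: "simple_graph G" and e: "embeds G x t e"
  shows "local_view G t (e []) = canonical_view x t e"
proof -
  have reach: "reach_le G (e []) u t \<longleftrightarrow> u \<in> e ` ball x t" for u
    using reach_le_iff_ball[OF e] by simp
  then have "(\<lambda>u. if reach_le G (e []) u t then deg G u else 0) =
      (\<lambda>u. if u \<in> e ` ball x t then port_count else 0)"
    using deg_embeds[OF x e] by (auto simp: fun_eq_iff)
  then show ?thesis
    using local_view_edges[OF G e] reach by (simp add: local_view_def canonical_view_def)
qed

definition simulated_output :: "algorithm \<Rightarrow> nat \<Rightarrow> nat \<Rightarrow> ptree \<Rightarrow> nat set \<Rightarrow> nat" where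
  "simulated_output Alg n t x S = (let e = placement (ball x t) (before x) S
     in Alg n port_count (canonical_view x t e) (e []))"

lemma simulated_output_cong:
  assumes "agree t x y"
  shows "simulated_output Alg n t x S = simulated_output Alg n t y S"
proof -
  have ball: "ball x t = ball y t" using ball_cong[OF assms] .
  have "before x b a \<longleftrightarrow> before y b a" if "a \<in> ball y t" "b \<in> ball y t" for a b
    using before_cong[OF assms] that by (simp add: ball_def)
  then have "rank (ball x t) (before x) a = rank (ball y t) (before y) a" if "a \<in> ball x t" for a
    using that unfolding rank_def ball by (metis (mono_tags, lifting) Collect_cong)
  then have "placement (ball x t) (before x) S a = placement (ball y t) (before y) S a"
    if "a \<in> ball x t" for a
    using that by (simp add: placement_def)
  then have "canonical_view x t (placement (ball x t) (before x) S) =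
      canonical_view x t (placement (ball y t) (before y) S)"
    and "placement (ball x t) (before x) S [] = placement (ball y t) (before y) S []"
    by (simp_all cong: canonical_view_cong)
  moreover have "canonical_view x t e = canonical_view y t e" for e
    by (simp add: canonical_view_def ball)
  ultimately show ?thesis by (simp add: simulated_output_def Let_def)
qed

lemma run_eq_simulated_output:
  assumes x: "valid_tree x" and G: "simple_graph G" "max_deg G = port_count"
    and e: "embeds G x (T port_count) e"
  shows "run Alg T G (e []) =
    simulated_output Alg (card (fst G)) (T port_count) x (e ` ball x (T port_count))"
proof -
  let ?f = "placement (ball x (T port_count)) (before x) (e ` ball x (T port_count))"
  have e_eq: "e a = ?f a" if "a \<in> ball x (T port_count)" for a
    using order_iso_eq_placement[OF embeds_order_iso[OF e] _ that] finite_ball by simp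
  have "local_view G (T port_count) (e []) = canonical_view x (T port_count) ?f"
    using local_view_eq_canonical_view[OF x G(1) e] canonical_view_cong[OF e_eq] by simp
  then show ?thesis using e_eq[of "[]"] by (simp add: run_def simulated_output_def G(2))
qed

subsection \<open>Trees as graphs\<close>

definition tree_graph :: "ptree \<Rightarrow> nat \<Rightarrow> (nat list \<Rightarrow> nat) \<Rightarrow> graph" where
  "tree_graph x L i = (i ` ball x L, (\<lambda>a. {i a, i (butlast a)}) ` (ball x L - {[]}))"

lemma fst_tree_graph [simp]: "fst (tree_graph x L i) = i ` ball x L"
  by (simp add: tree_graph_def)

lemma butlast_in_same_ball: "a \<in> ball x L \<Longrightarrow> butlast a \<in> ball x L"
  using butlast_in_ball[of a x L] ball_mono[of "L - 1" L x] by auto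

lemma children_in_ball:
  assumes "a \<in> ball x L"
  shows "{b \<in> ball x L. b \<noteq> [] \<and> butlast b = a} =
    (if length a < L then (\<lambda>r. a @ [r]) ` ({..<port_count} - {x a}) else {})" (is "?S = ?T")
proof (intro subset_antisym subsetI)
  fix b assume b: "b \<in> ?S"
  then obtain s where "b = a @ [s]"
    by (metis (mono_tags, lifting) append_butlast_last_id mem_Collect_eq)
  then show "b \<in> ?T" using b by (auto simp: ball_def reduced_snoc)
next
  fix b assume "b \<in> ?T"
  then show "b \<in> ?S" using assms by (auto simp: ball_def reduced_snoc split: if_splits)
qed

lemma nbrs_tree_graph:
  assumes inj: "inj_on i (ball x L)" and a: "a \<in> ball x L"
  shows "nbrs (tree_graph x L i) (i a) =
    (if length a < L then i ` adj x a else if a = [] then {} else {i (butlast a)})"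
proof -
  let ?C = "{b \<in> ball x L. b \<noteq> [] \<and> butlast b = a}"
  have eq: "i b = i c \<longleftrightarrow> b = c" if "b \<in> ball x L" "c \<in> ball x L" for b c
    using inj_on_eq_iff[OF inj that] .
  have "u \<in> nbrs (tree_graph x L i) (i a) \<longleftrightarrow>
      u \<in> i ` ?C \<union> (if a = [] then {} else {i (butlast a)})" for u
  proof -
    have "u \<in> nbrs (tree_graph x L i) (i a) \<longleftrightarrow>
        (\<exists>b\<in>ball x L. b \<noteq> [] \<and> {u, i a} = {i b, i (butlast b)})"
      by (auto simp: nbrs_def tree_graph_def)
    also have "\<dots> \<longleftrightarrow> (\<exists>b\<in>ball x L. b \<noteq> [] \<and> (u = i b \<and> a = butlast b \<or> u = i (butlast b) \<and> a = b))"
      using eq a butlast_in_same_ball by (auto simp: doubleton_eq_iff)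
    also have "\<dots> \<longleftrightarrow> u \<in> i ` ?C \<union> (if a = [] then {} else {i (butlast a)})"
      using a by auto
    finally show ?thesis .
  qed
  then have "nbrs (tree_graph x L i) (i a) = i ` ?C \<union> (if a = [] then {} else {i (butlast a)})"
    by blast
  then show ?thesis unfolding children_in_ball[OF a] adj_def by (simp add: image_Un)
qed

lemma deg_tree_graph:
  assumes x: "valid_tree x" and inj: "inj_on i (ball x L)" and a: "a \<in> ball x L" "a \<noteq> [] \<or> 0 < L"
  shows "deg (tree_graph x L i) (i a) = (if length a < L then port_count else 1)"
proof (cases "length a < L")
  case True
  then obtain k where "L = Suc k" "a \<in> ball x k" using a by (cases L) (auto simp: ball_def)
  then have "inj_on i (adj x a)" using adj_subset_ball inj by (blast intro: inj_on_subset)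
  then show ?thesis
    using True nbrs_tree_graph[OF inj a(1)] card_adj[OF x, of a] a(1)
    by (simp add: deg_def ball_def card_image)
next
  case False
  then show ?thesis using a nbrs_tree_graph[OF inj a(1)] by (auto simp: deg_def)
qed

lemma simple_tree_graph:
  assumes inj: "inj_on i (ball x L)"
  shows "simple_graph (tree_graph x L i)"
proof -
  have "card {i a, i (butlast a)} = 2" if "a \<in> ball x L" "a \<noteq> []" for a
  proof -
    have "a \<noteq> butlast a"
      using that(2) by (metis append_butlast_last_id append_self_conv list.distinct(1))
    then have "i a \<noteq> i (butlast a)" using inj_onD[OF inj] that(1) butlast_in_same_ball by blast
    then show ?thesis by simp
  qed
  moreover have "ball x L \<noteq> {}" using Nil_in_ball by blast
  ultimately show ?thesis
    using butlast_in_same_ball finite_ball by (auto simp: simple_graph_def tree_graph_def)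
qed

lemma connected_tree_graph: "connected_graph (tree_graph x L i)"
proof (rule connected_graphI[of "i []"])
  let ?G = "tree_graph x L i"
  show "i [] \<in> fst ?G" by simp
  have "(i [], i a) \<in> (edge_rel ?G)\<^sup>*" if "a \<in> ball x L" for a
    using that
  proof (induction a rule: rev_induct)
    case (snoc r a)
    have "a \<in> ball x L" using butlast_in_same_ball[OF snoc.prems] by simp
    then have "(i [], i a) \<in> (edge_rel ?G)\<^sup>*" by (rule snoc.IH)
    moreover have "{i (a @ [r]), i (butlast (a @ [r]))} \<in> snd ?G"
      unfolding tree_graph_def using snoc.prems by (auto simp del: butlast_snoc)
    then have "(i a, i (a @ [r])) \<in> edge_rel ?G" by (simp add: edge_rel_def insert_commute)
    ultimately show ?case by (rule rtrancl_into_rtrancl)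
  qed simp
  then show "(i [], u) \<in> (edge_rel ?G)\<^sup>*" if "u \<in> fst ?G" for u
    using that by auto
qed

lemma odd_tree_graph:
  assumes "valid_tree x" "0 < L" "inj_on i (ball x L)"
  shows "odd_graph port_count (tree_graph x L i)"
  using simple_tree_graph connected_tree_graph assms
  by (auto simp: odd_graph_def deg_tree_graph port_count_def)

lemma ex_address:
  assumes "0 < m"
  shows "\<exists>a. reduced x a \<and> length a = L"
proof (induction L)
  case (Suc L)
  then obtain a where a: "reduced x a" "length a = L" by blast
  define r where "r = (if x a = 0 then 1 else 0 :: nat)"
  have "r < port_count" "r \<noteq> x a" using assms by (auto simp: r_def port_count_def)
  then have "reduced x (a @ [r])" using a by (simp add: reduced_snoc)
  then show ?case using a(2) by (metis length_append_singleton)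
qed simp

lemma max_deg_eqI:
  assumes "simple_graph G" "v \<in> fst G" "deg G v = d" "\<And>u. u \<in> fst G \<Longrightarrow> deg G u \<le> d"
  shows "max_deg G = d"
  unfolding max_deg_def using assms by (intro Max_eqI) (auto simp: simple_graph_def)

lemma ex_odd_graph_extending_tree:
  assumes x: "valid_tree x" and m: "0 < m" and i: "bij_betw i (ball x (Suc t)) S"
    and S: "S \<subseteq> {1..n}" "n = card S + 2 * j"
  shows "\<exists>G. fst G = {1..n} \<and> odd_graph port_count G \<and> (\<forall>a\<in>ball x t. nbrs G (i a) = i ` adj x a)"
proof -
  have inj: "inj_on i (ball x (Suc t))" and im: "i ` ball x (Suc t) = S"
    using i by (auto simp: bij_betw_def)
  define H where "H = tree_graph x (Suc t) i"
  have fst_H: "fst H = S" by (simp add: H_def im)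
  obtain l where l: "reduced x l" "length l = Suc t" using ex_address[OF m] by blast
  then have l_ball: "l \<in> ball x (Suc t)" by (simp add: ball_def)
  have "deg H (i l) = 1" using deg_tree_graph[OF x inj l_ball] l(2) by (simp add: H_def)
  moreover have "odd_graph port_count H" using odd_tree_graph[OF x _ inj] by (simp add: H_def)
  moreover have "i l \<in> fst H" using l_ball im fst_H by blast
  moreover have "3 \<le> port_count" using m by (simp add: port_count_def)
  moreover have "card ({1..n} - S) = 2 * j"
    using card_Diff_subset[OF finite_subset[OF S(1)] S(1)] S(2) by simp
  moreover have "({1..n} - S) \<inter> fst H = {}" "fst H \<union> ({1..n} - S) = {1..n}"
    using S(1) fst_H by auto
  ultimately obtain G where G: "fst G = {1..n}" "odd_graph port_count G"
      "\<And>v. v \<in> S - {i l} \<Longrightarrow> nbrs G v = nbrs H v"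
    using ex_padded_odd_graph[of port_count H "i l" "{1..n} - S" j] unfolding fst_H by blast
  have "nbrs G (i a) = i ` adj x a" if a: "a \<in> ball x t" for a
  proof -
    have a_Suc: "a \<in> ball x (Suc t)" and "length a < Suc t" using a by (auto simp: ball_def)
    then have "i a \<noteq> i l" using inj_on_eq_iff[OF inj a_Suc l_ball] l(2) by auto
    then have "nbrs G (i a) = nbrs H (i a)" using G(3) a_Suc im by blast
    then show ?thesis using nbrs_tree_graph[OF inj a_Suc] \<open>length a < Suc t\<close> by (simp add: H_def)
  qed
  then show ?thesis using G(1,2) by blast
qed

lemma ex_odd_instance_embedding:
  assumes x: "valid_tree x" and m: "0 < m" and S: "S \<subseteq> {1..n}" "card S = ball_size (Suc t)"
    and n: "n = ball_size (Suc t) + 2 * j"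
  shows "\<exists>G i. odd_instance 1 G \<and> fst G = {1..n} \<and> max_deg G = port_count \<and>
    embeds G x t i \<and> i ` ball x (Suc t) = S"
proof -
  define i where "i = placement (ball x (Suc t)) (before x) S"
  have "finite S" using S(1) finite_subset by blast
  then have iso: "order_iso (ball x (Suc t)) (before x) S i"
    unfolding i_def using x S(2) by (intro order_iso_before_placement)
  then have bij: "bij_betw i (ball x (Suc t)) S" by (simp add: order_iso_def)
  then have inj: "inj_on i (ball x (Suc t))" and im: "i ` ball x (Suc t) = S"
    by (auto simp: bij_betw_def)
  obtain G where G: "fst G = {1..n}" "odd_graph port_count G"
      "\<And>a. a \<in> ball x t \<Longrightarrow> nbrs G (i a) = i ` adj x a"
    using ex_odd_graph_extending_tree[OF x m bij S(1), of j] n S(2) by auto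
  have root: "i [] \<in> fst G" using im S(1) G(1) Nil_in_ball by blast
  have embeds: "embeds G x t i"
    using root inj G(3) iso by (simp add: embeds_def order_iso_def ball_SucI)
  then have "deg G (i []) = port_count" using deg_embeds[OF x] by simp
  then have "max_deg G = port_count"
    using G(2) root by (intro max_deg_eqI) (auto simp: odd_graph_def)
  moreover have "odd_instance 1 G" using G(1,2) by (auto simp: odd_instance_def odd_graph_def)
  ultimately show ?thesis using G(1) embeds im by blast
qed

end

lemma odd_instance_mono:
  assumes "odd_instance c G" "c \<le> c'"
  shows "odd_instance c' G"
proof -
  have "0 < card (fst G)"
    using assms(1) by (auto simp: odd_instance_def simple_graph_def card_gt_0_iff)
  then have "card (fst G) ^ c \<le> card (fst G) ^ c'" using assms(2) by (intro power_increasing) auto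
  then have "{1..card (fst G) ^ c} \<subseteq> {1..card (fst G) ^ c'}" by auto
  then show ?thesis using assms(1) unfolding odd_instance_def by blast
qed

context ported_trees
begin

subsection \<open>From weak 2-colorings to superweak colorings\<close>

definition restrict_depth :: "nat \<Rightarrow> ptree \<Rightarrow> ptree" where
  "restrict_depth t x = (\<lambda>a. if length a \<le> t then x a else 0)"

lemma restrict_depth_eq_iff: "restrict_depth t x = restrict_depth t y \<longleftrightarrow> agree t x y"
  unfolding restrict_depth_def agree_def fun_eq_iff by metis

lemma set_reduced_subset: "reduced y a \<Longrightarrow> set a \<subseteq> {..<port_count}"
  by (induction a arbitrary: y) (auto simp: exits_def)

lemma finite_restrict_depth: "finite (restrict_depth t ` Collect valid_tree)"
proof (rule finite_subset)
  let ?A = "{a. set a \<subseteq> {..<port_count} \<and> length a \<le> t}"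
  let ?F = "{f. \<forall>a. (a \<in> ?A \<longrightarrow> f a \<in> {..port_count}) \<and> (a \<notin> ?A \<longrightarrow> f a = 0)}"
  show "restrict_depth t ` Collect valid_tree \<subseteq> ?F"
  proof (rule image_subsetI)
    fix x assume "x \<in> Collect valid_tree"
    then have x: "valid_tree x" by simp
    have "x a \<le> port_count" for a
      using valid_tree_Nil[OF x] entry_less[OF x, of a] not_reduced_entry[of x a] x
      by (cases "reduced x a"; cases "a = []") (auto simp: valid_tree_def)
    moreover have "x a = 0" if "\<not> set a \<subseteq> {..<port_count}" for a
    proof -
      have "\<not> reduced x a" using that set_reduced_subset by blast
      then show ?thesis using not_reduced_entry x by (simp add: valid_tree_def)
    qed
    ultimately show "restrict_depth t x \<in> ?F" by (simp add: restrict_depth_def)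
  qed
  show "finite ?F" by (intro finite_set_of_finite_funs finite_lists_length_le) auto
qed

definition homogeneous :: "algorithm \<Rightarrow> nat \<Rightarrow> nat \<Rightarrow> nat set \<Rightarrow> bool" where
  "homogeneous Alg n t S \<longleftrightarrow> (\<forall>X\<in>nsets S (ball_size t). \<forall>Y\<in>nsets S (ball_size t). \<forall>x. valid_tree x \<longrightarrow>
     (simulated_output Alg n t x X = 1 \<longleftrightarrow> simulated_output Alg n t x Y = 1))"

text \<open>Ramsey's theorem is applied to the coloring of a set \<open>X\<close> of identifiers by the set of all
  radius-\<open>t\<close> neighborhoods that output 1 when they receive the identifiers \<open>X\<close>.\<close>

lemma ex_homogeneous:
  "\<exists>n j S. n = s + 2 * j \<and> S \<subseteq> {1..n} \<and> card S = s \<and> homogeneous Alg n t S"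
proof -
  define C where "C = Pow (restrict_depth t ` Collect valid_tree)"
  have "finite C" unfolding C_def using finite_restrict_depth by simp
  then obtain N :: nat where N: "\<And>f. range f \<subseteq> C \<Longrightarrow>
      \<exists>H\<in>nsets {..<N} (Suc s). \<exists>c. \<forall>X\<in>nsets H (ball_size t). f X = c"
    by (rule ramsey_finite_range[where r = "ball_size t" and s = "Suc s"]) (rule that)
  define n where "n = s + 2 * N"
  define accepted where "accepted X =
      restrict_depth t ` {x. valid_tree x \<and> simulated_output Alg n t x X = 1}" for X
  have range: "range accepted \<subseteq> C" by (auto simp: accepted_def C_def)
  obtain H c where H: "H \<in> nsets {..<N} (Suc s)" "\<And>X. X \<in> nsets H (ball_size t) \<Longrightarrow> accepted X = c"
    using N[OF range] by blast
  have "s \<le> card (H - {0})" using H(1) by (auto simp: nsets_def card_Diff_singleton_if)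
  then obtain S where S: "S \<subseteq> H - {0}" "card S = s" by (meson obtain_subset_with_card_n)
  have "S \<subseteq> {1..n}" using S(1) H(1) by (fastforce simp: nsets_def n_def)
  moreover have "homogeneous Alg n t S"
    unfolding homogeneous_def
  proof (intro ballI allI impI)
    fix X Y x
    assume XY: "X \<in> nsets S (ball_size t)" "Y \<in> nsets S (ball_size t)" and x: "valid_tree x"
    have accepted_iff: "restrict_depth t x \<in> accepted Z \<longleftrightarrow> simulated_output Alg n t x Z = 1" for Z
      using x simulated_output_cong by (auto simp: accepted_def restrict_depth_eq_iff)
    have "nsets S (ball_size t) \<subseteq> nsets H (ball_size t)" using S(1) by (intro nsets_mono) blast
    then have "accepted X = accepted Y" using H(2) XY by blast
    then show "simulated_output Alg n t x X = 1 \<longleftrightarrow> simulated_output Alg n t x Y = 1"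
      using accepted_iff by blast
  qed
  ultimately show ?thesis using S(2) n_def by blast
qed

definition order_output :: "algorithm \<Rightarrow> nat \<Rightarrow> nat \<Rightarrow> nat set \<Rightarrow> ptree \<Rightarrow> bool" where
  "order_output Alg n t S x \<longleftrightarrow> (\<exists>X\<in>nsets S (ball_size t). simulated_output Alg n t x X = 1)"

lemma order_output_cong: "agree t x y \<Longrightarrow> order_output Alg n t S x \<longleftrightarrow> order_output Alg n t S y"
  unfolding order_output_def using simulated_output_cong by simp

lemma order_output_iff_run:
  assumes hom: "homogeneous Alg (card (fst G)) (T port_count) S"
    and x: "valid_tree x" and G: "simple_graph G" "max_deg G = port_count"
    and e: "embeds G x (T port_count) e" "e ` ball x (T port_count) \<subseteq> S"
  shows "order_output Alg (card (fst G)) (T port_count) S x \<longleftrightarrow> run Alg T G (e []) = 1"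
proof -
  let ?X = "e ` ball x (T port_count)"
  have "?X \<in> nsets S (ball_size (T port_count))"
    using e(2) card_image[OF embeds_inj_on_ball[OF e(1)]] card_ball[OF x] finite_ball
    by (simp add: nsets_def)
  then have "order_output Alg (card (fst G)) (T port_count) S x \<longleftrightarrow>
      simulated_output Alg (card (fst G)) (T port_count) x ?X = 1"
    using hom x unfolding homogeneous_def order_output_def by blast
  then show ?thesis using run_eq_simulated_output[where T = T and e = e, OF x G e(1)] by simp
qed

lemma order_output_reroot_iff_run:
  assumes hom: "homogeneous Alg (card (fst G)) (T port_count) S"
    and x: "valid_tree x" and p: "p < port_count"
    and G: "simple_graph G" "max_deg G = port_count"
    and e: "embeds G x (Suc (T port_count)) e" "e ` ball x (Suc (T port_count)) \<subseteq> S"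
  shows "order_output Alg (card (fst G)) (T port_count) S (reroot x p) \<longleftrightarrow> run Alg T G (e [p]) = 1"
proof -
  have "(\<lambda>a. e (reroot_address x p a)) ` ball (reroot x p) (T port_count) \<subseteq> S"
    using e(2) reroot_address_in_ball[OF x p] by blast
  then show ?thesis
    using order_output_iff_run[where T = T and e = "\<lambda>a. e (reroot_address x p a)",
        OF hom valid_tree_reroot[OF x p] G embeds_reroot[OF G(1) x p e(1)]]
    by simp
qed

lemma ex_port_order_output_neq:
  assumes m: "0 < m" and c: "1 \<le> c" and solves: "solves_weak2_odd c Alg T"
    and S: "S \<subseteq> {1..n}" "card S = ball_size (Suc (Suc (T port_count)))"
    and n: "n = ball_size (Suc (Suc (T port_count))) + 2 * j"
    and hom: "homogeneous Alg n (T port_count) S" and x: "valid_tree x"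
  shows "\<exists>p<port_count. order_output Alg n (T port_count) S (reroot x p) \<noteq>
    order_output Alg n (T port_count) S x"
proof -
  let ?t = "T port_count"
  obtain G i where G: "odd_instance 1 G" "fst G = {1..n}" "max_deg G = port_count"
    and i: "embeds G x (Suc ?t) i" "i ` ball x (Suc (Suc ?t)) = S"
    using ex_odd_instance_embedding[OF x m S n] by blast
  have simple: "simple_graph G" and card_G: "card (fst G) = n"
    using G(1,2) by (auto simp: odd_instance_def)
  have col: "weak_2_coloring G (run Alg T G)"
    using solves odd_instance_mono[OF G(1) c] unfolding solves_weak2_odd_def by blast
  have i_S: "i ` ball x (Suc ?t) \<subseteq> S" "i ` ball x ?t \<subseteq> S" using i(2) ball_SucI by blast+
  have root: "order_output Alg n ?t S x \<longleftrightarrow> run Alg T G (i []) = 1"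
    using order_output_iff_run[where T = T and e = i, OF _ x simple G(3) embeds_mono[OF i(1)] i_S(2)]
      hom card_G by simp
  have nbr: "order_output Alg n ?t S (reroot x p) \<longleftrightarrow> run Alg T G (i [p]) = 1"
    if p: "p < port_count" for p
    using order_output_reroot_iff_run[where T = T and e = i, OF _ x p simple G(3) i(1) i_S(1)]
      hom card_G by simp
  have iG: "i [] \<in> fst G" using embeds_root[OF i(1)] .
  have "deg G (i []) = port_count" using deg_embeds[OF x i(1)] by simp
  then have "1 \<le> deg G (i [])" by (simp add: port_count_def)
  then obtain u where u: "u \<in> nbrs G (i [])" "run Alg T G u \<noteq> run Alg T G (i [])"
    using col iG by (auto simp: weak_2_coloring_def)
  then obtain p where p: "p < port_count" "u = i [p]"
    using embeds_nbrs[OF i(1), of "[]"] adj_root[OF x] by auto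
  have "run Alg T G u \<in> {1, 2}" "run Alg T G (i []) \<in> {1, 2}"
    using col iG nbrs_in[OF simple u(1)] by (auto simp: weak_2_coloring_def)
  then show ?thesis using root nbr[OF p(1)] u(2) p by auto
qed

lemma superweak_colorable_2_if_ex_port_neq:
  assumes cong: "\<And>x y. agree t x y \<Longrightarrow> f x \<longleftrightarrow> f y"
    and neq: "\<And>x. valid_tree x \<Longrightarrow> \<exists>p<port_count. f (reroot x p) \<noteq> f x"
  shows "superweak_colorable m (Suc t) 2"
proof -
  define demands where "demands x = {p. p < port_count \<and> f (reroot x p) \<noteq> f x}" for x
  have "superweak_coloring m (Suc t) 2 (\<lambda>x. if f x then 0 else 1) demands (\<lambda>_. {})"
  proof
    fix x y assume xy: "agree (Suc t) x y"
    have "f x = f y" using cong agree_mono[OF xy, of t] by simp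
    moreover have "f (reroot x p) = f (reroot y p)" for p
      using cong agree_reroot_Suc[OF xy] by blast
    ultimately show "(if f x then 0 else 1::nat) = (if f y then 0 else 1)" "demands x = demands y"
      by (auto simp: demands_def)
  next
    fix x assume "valid_tree x"
    then have "demands x \<noteq> {}" using neq by (auto simp: demands_def)
    then show "card ({} :: nat set) < card (demands x)" by (simp add: card_gt_0_iff demands_def)
  qed (auto simp: demands_def split: if_splits)
  then show ?thesis unfolding superweak_colorable_def by blast
qed

lemma superweak_colorable_of_weak_2_coloring:
  assumes "0 < m" "1 \<le> c" "solves_weak2_odd c Alg T"
  shows "superweak_colorable m (Suc (T port_count)) 2"
proof -
  obtain n j S where "n = ball_size (Suc (Suc (T port_count))) + 2 * j" "S \<subseteq> {1..n}"
      "card S = ball_size (Suc (Suc (T port_count)))" "homogeneous Alg n (T port_count) S"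
    using ex_homogeneous[of "ball_size (Suc (Suc (T port_count)))" Alg "T port_count"] by blast
  then show ?thesis
    using assms
    by (intro superweak_colorable_2_if_ex_port_neq[where f = "order_output Alg n (T port_count) S"]
        order_output_cong ex_port_order_output_neq)
qed

end

lemma weak_2_coloring_rounds_bound:
  assumes c: "1 \<le> c" and solves: "solves_weak2_odd c Alg T"
  shows "h \<le> 7 * Suc (T (2 * tower h + 3))"
proof (rule ccontr)
  assume "\<not> ?thesis"
  then have "1 + 7 * Suc (T (2 * tower h + 3)) \<le> h" by simp
  define m where "m = Suc (tower h)"
  interpret ported_trees m .
  have ports: "port_count = 2 * tower h + 3" by (simp only: port_count_def) (simp add: m_def)
  have "tower (1 + 7 * Suc (T port_count)) \<le> tower h"
    unfolding ports strict_mono_less_eq[OF strict_mono_tower] by fact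
  then have "tower (1 + 7 * Suc (T port_count)) < m" by (simp add: m_def)
  then have "\<not> superweak_colorable m (Suc (T port_count)) (tower 1)"
    by (rule not_superweak_colorable)
  moreover have "tower 1 = 2" by simp
  ultimately show False
    using superweak_colorable_of_weak_2_coloring[OF _ c solves] by (simp add: m_def)
qed

theorem theorem9:
  fixes c :: nat
  assumes "c \<ge> 1"
  shows "\<not> (\<exists>(A :: algorithm) (T :: nat \<Rightarrow> nat).
            (\<lambda>d. real (T d)) \<in> o(\<lambda>d. real (log_star (real d))) \<and> solves_weak2_odd c A T)"
proof (intro notI, elim exE conjE)
  fix A :: algorithm and T :: "nat \<Rightarrow> nat"
  assume small: "(\<lambda>d. real (T d)) \<in> o(\<lambda>d. real (log_star (real d)))"
    and solves: "solves_weak2_odd c A T"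
  have "eventually (\<lambda>d. norm (real (T d)) \<le> 1/14 * norm (real (log_star (real d)))) sequentially"
    by (rule landau_o.smallD[OF small]) simp
  then obtain d0 where d0: "\<And>d. d0 \<le> d \<Longrightarrow> real (T d) \<le> 1/14 * real (log_star (real d))"
    by (auto simp: eventually_sequentially)
  define h where "h = d0 + 17"
  define d where "d = 2 * tower h + 3"
  have "h \<le> tower h" using strict_mono_imp_increasing[OF strict_mono_tower] .
  then have "real (T d) \<le> 1/14 * real (log_star (real d))" by (intro d0) (simp add: d_def h_def)
  moreover have "d \<le> tower (h + 2)"
    unfolding d_def by (rule double_tower_add_3_le) (simp add: h_def)
  then have "log_star (real d) \<le> h + 2" by (intro log_star_le_tower) simp
  ultimately have "14 * T d \<le> h + 2" by linarith
  moreover have "h \<le> 7 * Suc (T d)"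
    unfolding d_def using weak_2_coloring_rounds_bound[OF assms solves] .
  ultimately show False by (simp add: h_def)
qed

end
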